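(* Let $n\ge1$ and $R\subseteq\{1,\dots,n-1\}$. (a) For every $k\ge1$, $$F_{n,R}\!\left[\frac{1}{(1-q_1)\cdots(1-q_k)}\right]=\frac{\sum_{\vec{\sigma}\in S_n^{\times(k-1)}}q_1^{\mathrm{comaj}^1_R(\vec\sigma)}\cdots q_k^{\mathrm{comaj}^k_R(\vec\sigma)}}{(q_1;q_1)_n\cdots(q_k;q_k)_n}.$$ (b) In the infinite case, $$F_{n,R}\!\left[\frac{1}{(1-q_1)(1-q_2)\cdots}\right]=\frac{\sum_{\vec\sigma\in{}_RS_n^\infty}Q^{\mathrm{Comaj}_R(\vec\sigma)}}{(q_1;q_1)_n(q_2;q_2)_n\cdots}.$$
   Context: $\mathbb{N}=\{0,1,\dots\}$; sequences in $\mathbb{N}^r$ (and finitely supported sequences in $\mathbb{N}^\infty$) are compared lexicographically, the first coordinate being most significant. $(q;t)_r=(1-q)(1-qt)\cdots(1-qt^{r-1})$; $\epsilon$ is the identity of $S_n$. Gessel's fundamental quasisymmetric function is $F_{n,R}=\sum x_{a_1}\cdots x_{a_n}$ over $a_1\le\cdots\le a_n$ with $a_i<a_{i+1}$ for $i\in R$. By definition here, $F_{n,R}[1/((1-q_1)\cdots(1-q_k))]=\sum q^S$ over $S=(s^1,\dots,s^n)\in(\mathbb{N}^k)^n$ with $s^1\le\cdots\le s^n$ and $s^i<s^{i+1}$ for $i\in R$, where $q^S=\prod_{i=1}^k q_i^{\sum_j s^j_{k-i+1}}$; and $F_{n,R}[1/((1-q_1)(1-q_2)\cdots)]=\sum Q^Z$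 over $Z=(z^1,\dots,z^n)$ of finitely supported sequences in $\mathbb{N}^\infty$ with $z^1\le\cdots\le z^n$ and $z^i<z^{i+1}$ for $i\in R$, where $Q^Z=\prod_{i\ge1}q_i^{\sum_j z^j_i}$. For distinct $a,b$, $a\sim_R b$ if all of $\min(a,b),\dots,\max(a,b)-1$ lie in $R$. For $S\in(\mathbb{N}^r)^n$ (if $r=0$ all $s^i$ empty and equal) and $\sigma\in S_n$, $\mathrm{Des}_{R,S}(\sigma)$ is the set of $i\in\{1,\dots,n-1\}$ with either $s^{\sigma_i}>s^{\sigma_{i+1}}$, or $s^{\sigma_i}=s^{\sigma_{i+1}}$ and either ($\sigma_{i+1}<\sigma_i$ and not $\sigma_{i+1}\sim_R\sigma_i$) or ($\sigma_{i+1}>\sigma_i$ and $\sigma_i\sim_R\sigma_{i+1}$). $\mathrm{Comaj}_{R,S}(\sigma)=\sum_{i\in\mathrm{Des}_{R,S}(\sigma)}(n-i)$. $Z_{R,\sigma}(S)\in(\mathbb{N}^{r+1})^n$ prepends to each $s^j$ a first coordinate $z^j_1$ with $z^{\sigma_i}_1=\#\{j<i:j\in\mathrm{Des}_{R,S}(\sigma)\}$. For $\vec\pi=(\pi^1,\dots,\pi^{k-1})\in S_n^{\times(k-1)}$, set $\pi^k=\epsilon$, $Z^0=$ list of $n$ empty sequences, $Z^i=Z_{R,\pi^i}(Z^{i-1})$, and $\mathrm{comaj}^i_R(\vec\pi)=\mathrm{Comaj}_{R,Z^{i-1}}(\pi^i)$, $1\le i\le k$. Let $\tau_R\in S_n$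 be the unique permutation with $\mathrm{Comaj}_{R,\emptyset}(\tau_R)=0$ ($\emptyset$ = list of $n$ empty sequences). ${}_RS_n^\infty$ is the set of sequences $(\sigma^1,\sigma^2,\dots)$ in $S_n$ with $\sigma^1=\epsilon$ and $\sigma^i=\tau_R$ for all large $i$; for such $\vec\sigma$ let $m\ge1$ be smallest with $\sigma^i=\tau_R$ for all $i>m$, and $Q^{\mathrm{Comaj}_R(\vec\sigma)}=\prod_{j=1}^m q_j^{\mathrm{comaj}^{m-j+1}_R(\sigma^m,\dots,\sigma^2)}$ (the tuple $(\sigma^m,\dots,\sigma^2)$ has length $m-1$). *)

theory Defs
  imports "HOL-Computational_Algebra.Polynomial" "HOL-Combinatorics.Permutations"
begin

(* ---------- formal power series in variables q_1, q_2, ... ----------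
   A monomial q_1^{e 1} q_2^{e 2} ... is an exponent function e :: nat => nat
   (index 0 is unused; meaningful monomials have e 0 = 0 and finite support).
   A formal power series is its coefficient function. *)
type_synonym mon = "nat \<Rightarrow> nat"
type_synonym mps = "mon \<Rightarrow> int"

definition finsupp_mon :: "mon \<Rightarrow> bool" where
  "finsupp_mon e \<longleftrightarrow> finite {i. e i \<noteq> 0}"

(* Cauchy product of formal power series (coefficientwise, finite sum for
   finitely supported monomials) *)
definition mps_mult :: "mps \<Rightarrow> mps \<Rightarrow> mps" where
  "mps_mult f g e = (\<Sum>d\<in>{d. \<forall>i. d i \<le> e i}. f d * g (\<lambda>i. e i - d i))"

definition qpoch :: "nat \<Rightarrow> int poly" where
  "qpoch n = (\<Prod>m\<in>{1..n}. 1 - monom 1 m)"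

(* the series  prod_{i in V} (q_i;q_i)_n  (V a set of variable indices >= 1;
   for infinite V this is the (formally convergent) infinite product) *)
definition qpoch_prod :: "nat \<Rightarrow> nat set \<Rightarrow> mps" where
  "qpoch_prod n V e =
     (if (\<forall>i. i \<notin> V \<longrightarrow> e i = 0) \<and> finsupp_mon e
      then (\<Prod>i\<in>{i. e i \<noteq> 0}. coeff (qpoch n) (e i)) else 0)"

fun lexless :: "nat list \<Rightarrow> nat list \<Rightarrow> bool" where
  "lexless [] _ = False"
| "lexless (x # xs) [] = False"
| "lexless (x # xs) (y # ys) = (x < y \<or> (x = y \<and> lexless xs ys))"

definition lexle :: "nat list \<Rightarrow> nat list \<Rightarrow> bool" where
  "lexle xs ys \<longleftrightarrow> lexless xs ys \<or> xs = ys"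

(* lexicographic order on sequences z_1, z_2, ... (stored as nat => nat,
   index 0 unused and kept equal to 0) *)
definition seqless :: "(nat \<Rightarrow> nat) \<Rightarrow> (nat \<Rightarrow> nat) \<Rightarrow> bool" where
  "seqless z w \<longleftrightarrow> (\<exists>i. z i < w i \<and> (\<forall>l<i. z l = w l))"

definition seqle :: "(nat \<Rightarrow> nat) \<Rightarrow> (nat \<Rightarrow> nat) \<Rightarrow> bool" where
  "seqle z w \<longleftrightarrow> seqless z w \<or> z = w"

(* coefficient of q^e in F_{n,R}[1/((1-q_1)...(1-q_k))]:
   S = (s^1,...,s^n), s^j in N^k as a list of length k (s^j_m = S j ! (m-1)),
   q^S = prod_i q_i^{sum_j s^j_{k-i+1}} *)
definition F_fin_set :: "nat \<Rightarrow> nat set \<Rightarrow> nat \<Rightarrow> mon \<Rightarrow> (nat \<Rightarrow> nat list) set" where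
  "F_fin_set n R k e = {S.
      (\<forall>j. j \<notin> {1..n} \<longrightarrow> S j = []) \<and>
      (\<forall>j\<in>{1..n}. length (S j) = k) \<and>
      (\<forall>j\<in>{1..<n}. lexle (S j) (S (j+1))) \<and>
      (\<forall>j\<in>R. lexless (S j) (S (j+1))) \<and>
      (\<forall>i. e i = (if i \<in> {1..k} then (\<Sum>j=1..n. S j ! (k - i)) else 0))}"

definition F_fin :: "nat \<Rightarrow> nat set \<Rightarrow> nat \<Rightarrow> mps" where
  "F_fin n R k e = int (card (F_fin_set n R k e))"

(* coefficient of Q^e in F_{n,R}[1/((1-q_1)(1-q_2)...)]:
   Z = (z^1,...,z^n), z^j a finitely supported sequence (z^j_i = Z j i, i >= 1) *)
definition F_inf_set :: "nat \<Rightarrow> nat set \<Rightarrow> mon \<Rightarrow> (nat \<Rightarrow> nat \<Rightarrow> nat) set" where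
  "F_inf_set n R e = {Z.
      (\<forall>j. j \<notin> {1..n} \<longrightarrow> Z j = (\<lambda>_. 0)) \<and>
      (\<forall>j\<in>{1..n}. Z j 0 = 0 \<and> finite {i. Z j i \<noteq> 0}) \<and>
      (\<forall>j\<in>{1..<n}. seqle (Z j) (Z (j+1))) \<and>
      (\<forall>j\<in>R. seqless (Z j) (Z (j+1))) \<and>
      (\<forall>i. e i = (\<Sum>j=1..n. Z j i))}"

definition F_inf :: "nat \<Rightarrow> nat set \<Rightarrow> mps" where
  "F_inf n R e = int (card (F_inf_set n R e))"

definition simR :: "nat set \<Rightarrow> nat \<Rightarrow> nat \<Rightarrow> bool" where
  "simR R a b \<longleftrightarrow> a \<noteq> b \<and> {min a b..<max a b} \<subseteq> R"

(* Des_{R,S}(sigma); permutations of {1..n} are functions sigma with sigma permutes {1..n} *)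
definition Des :: "nat set \<Rightarrow> nat \<Rightarrow> (nat \<Rightarrow> nat list) \<Rightarrow> (nat \<Rightarrow> nat) \<Rightarrow> nat set" where
  "Des R n S \<sigma> = {i\<in>{1..<n}.
      lexless (S (\<sigma> (i+1))) (S (\<sigma> i)) \<or>
      (S (\<sigma> i) = S (\<sigma> (i+1)) \<and>
        ((\<sigma> (i+1) < \<sigma> i \<and> \<not> simR R (\<sigma> (i+1)) (\<sigma> i)) \<or>
         (\<sigma> (i+1) > \<sigma> i \<and> simR R (\<sigma> i) (\<sigma> (i+1)))))}"

definition Comaj :: "nat set \<Rightarrow> nat \<Rightarrow> (nat \<Rightarrow> nat list) \<Rightarrow> (nat \<Rightarrow> nat) \<Rightarrow> nat" where
  "Comaj R n S \<sigma> = (\<Sum>i\<in>Des R n S \<sigma>. n - i)"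

definition Zmap :: "nat set \<Rightarrow> nat \<Rightarrow> (nat \<Rightarrow> nat) \<Rightarrow> (nat \<Rightarrow> nat list) \<Rightarrow> (nat \<Rightarrow> nat list)" where
  "Zmap R n \<sigma> S = (\<lambda>j. card {d\<in>Des R n S \<sigma>. d < inv \<sigma> j} # S j)"

fun Zit :: "nat set \<Rightarrow> nat \<Rightarrow> (nat \<Rightarrow> nat \<Rightarrow> nat) \<Rightarrow> nat \<Rightarrow> (nat \<Rightarrow> nat list)" where
  "Zit R n \<pi> 0 = (\<lambda>j. [])"
| "Zit R n \<pi> (Suc i) = Zmap R n (\<pi> (Suc i)) (Zit R n \<pi> i)"

definition comaj :: "nat set \<Rightarrow> nat \<Rightarrow> nat \<Rightarrow> (nat \<Rightarrow> nat \<Rightarrow> nat) \<Rightarrow> nat \<Rightarrow> nat" where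
  "comaj R n k \<pi> i = (let \<pi>' = \<pi>(k := id) in Comaj R n (Zit R n \<pi>' (i - 1)) (\<pi>' i))"

definition perm_tuples :: "nat \<Rightarrow> nat \<Rightarrow> (nat \<Rightarrow> nat \<Rightarrow> nat) set" where
  "perm_tuples n k = {\<pi>. (\<forall>i\<in>{1..<k}. \<pi> i permutes {1..n}) \<and> (\<forall>i. i \<notin> {1..<k} \<longrightarrow> \<pi> i = id)}"

definition num_fin_set :: "nat \<Rightarrow> nat set \<Rightarrow> nat \<Rightarrow> mon \<Rightarrow> (nat \<Rightarrow> nat \<Rightarrow> nat) set" where
  "num_fin_set n R k e = {\<pi>\<in>perm_tuples n k.
      \<forall>i. e i = (if i \<in> {1..k} then comaj R n k \<pi> i else 0)}"

definition num_fin :: "nat \<Rightarrow> nat set \<Rightarrow> nat \<Rightarrow> mps" where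
  "num_fin n R k e = int (card (num_fin_set n R k e))"

definition tauR :: "nat set \<Rightarrow> nat \<Rightarrow> (nat \<Rightarrow> nat)" where
  "tauR R n = (THE \<tau>. \<tau> permutes {1..n} \<and> Comaj R n (\<lambda>j. []) \<tau> = 0)"

definition RSinf :: "nat set \<Rightarrow> nat \<Rightarrow> (nat \<Rightarrow> nat \<Rightarrow> nat) set" where
  "RSinf R n = {\<sigma>. \<sigma> 0 = id \<and> \<sigma> 1 = id \<and> (\<forall>i. \<sigma> i permutes {1..n}) \<and>
                    (\<exists>M. \<forall>i>M. \<sigma> i = tauR R n)}"

definition mstab :: "nat set \<Rightarrow> nat \<Rightarrow> (nat \<Rightarrow> nat \<Rightarrow> nat) \<Rightarrow> nat" where
  "mstab R n \<sigma> = (LEAST m. 1 \<le> m \<and> (\<forall>i>m. \<sigma> i = tauR R n))"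

(* exponent of q_j in Q^{Comaj_R(sigma)} = prod_{j=1}^m q_j^{comaj^{m-j+1}_R(sigma^m,...,sigma^2)} *)
definition Comaj_exp :: "nat set \<Rightarrow> nat \<Rightarrow> (nat \<Rightarrow> nat \<Rightarrow> nat) \<Rightarrow> mon" where
  "Comaj_exp R n \<sigma> j =
     (let m = mstab R n \<sigma>;
          \<pi> = (\<lambda>i. if i \<in> {1..<m} then \<sigma> (m + 1 - i) else id)
      in if j \<in> {1..m} then comaj R n m \<pi> (m - j + 1) else 0)"

definition num_inf_set :: "nat \<Rightarrow> nat set \<Rightarrow> mon \<Rightarrow> (nat \<Rightarrow> nat \<Rightarrow> nat) set" where
  "num_inf_set n R e = {\<sigma>\<in>RSinf R n. Comaj_exp R n \<sigma> = e}"

definition num_inf :: "nat \<Rightarrow> nat set \<Rightarrow> mps" where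
  "num_inf n R e = int (card (num_inf_set n R e))"

end

theory Submission
  imports Defs "HOL-Library.FuncSet" "HOL-Computational_Algebra.Polynomial_FPS"
begin

text \<open>
  Refine the lexicographic order on the entries of a tuple \<open>S\<close> by a tie-breaking order depending
  on \<open>R\<close>; then exactly one permutation sorts \<open>S\<close>, and \<open>Des\<close> records the adjacent inversions with
  respect to the refined order. If \<open>\<rho>\<close> sorts \<open>S\<close>, then \<open>\<sigma>\<close> sorts the tuple with the
  coordinate \<open>x\<close> prepended iff \<open>x \<circ> \<sigma>\<close> is weakly increasing and strictly so at the descents of
  \<open>\<rho>\<inverse> \<sigma>\<close>. Attaching to \<open>S\<close> the permutations sorting its successive tails, of which the first is
  \<open>\<tau>\<^sub>R\<close> and, for the tuples counted by \<open>F\<close>, the last is the identity, splits \<open>F\<close> into a sum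
  over tuples of permutations of products of one-variable series. Each of these enumerates the
  increasing sequences with prescribed strict ascents, hence equals \<open>q\<close> to a comajor index divided
  by \<open>(q;q)\<^sub>n\<close>.

  For (b), a monomial involves only \<open>q\<^sub>1, \<dots>, q\<^sub>k\<close> for some \<open>k\<close>, and the exponent of \<open>q\<^sub>j\<close>
  attached to a sequence \<open>\<sigma>\<close> is the comajor index of the inverse of \<open>\<sigma>\<^sup>j\<^sup>+\<^sup>1\<close> times \<open>\<sigma>\<^sup>j\<close>, which
  vanishes only if the two agree. So (b) is (a) with the variables in reverse order.
\<close>

section \<open>Sorting permutations and descents\<close>

definition sorts :: "nat \<Rightarrow> (nat \<Rightarrow> nat \<Rightarrow> bool) \<Rightarrow> (nat \<Rightarrow> nat) \<Rightarrow> bool" where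
  "sorts n L \<sigma> \<longleftrightarrow> \<sigma> permutes {1..n} \<and> (\<forall>i\<in>{1..<n}. L (\<sigma> i) (\<sigma> (i + 1)))"

definition strict_linear_on :: "'a set \<Rightarrow> ('a \<Rightarrow> 'a \<Rightarrow> bool) \<Rightarrow> bool" where
  "strict_linear_on A L \<longleftrightarrow> irreflp_on A L \<and> transp_on A L \<and> totalp_on A L"

lemma strict_linear_onD:
  assumes "strict_linear_on A L"
  shows "a \<in> A \<Longrightarrow> \<not> L a a"
    and "a \<in> A \<Longrightarrow> b \<in> A \<Longrightarrow> c \<in> A \<Longrightarrow> L a b \<Longrightarrow> L b c \<Longrightarrow> L a c"
    and "a \<in> A \<Longrightarrow> b \<in> A \<Longrightarrow> a \<noteq> b \<Longrightarrow> L a b \<or> L b a"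
  using assms unfolding strict_linear_on_def
  by (blast dest: irreflp_onD transp_onD totalp_onD)+

lemma strict_linear_on_not_iff:
  assumes "strict_linear_on A L" "a \<in> A" "b \<in> A" "a \<noteq> b"
  shows "\<not> L a b \<longleftrightarrow> L b a"
  using strict_linear_onD[OF assms(1)] assms(2-) by blast

lemma sorts_less_iff:
  assumes L: "strict_linear_on {1..n} L" and s: "sorts n L \<sigma>"
    and i: "i \<in> {1..n}" and j: "j \<in> {1..n}"
  shows "L (\<sigma> i) (\<sigma> j) \<longleftrightarrow> i < j"
proof -
  have mem: "\<sigma> x \<in> {1..n}" if "x \<in> {1..n}" for x
    using s that unfolding sorts_def by (metis permutes_in_image)
  have less: "L (\<sigma> x) (\<sigma> y)" if "x < y" "1 \<le> x" "y \<le> n" for x y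
    using that
  proof (induction y)
    case (Suc y)
    have step: "L (\<sigma> y) (\<sigma> (Suc y))"
      using s Suc.prems unfolding sorts_def by auto
    show ?case
    proof (cases "x = y")
      case False
      then have "L (\<sigma> x) (\<sigma> y)" using Suc by auto
      then show ?thesis
        using step strict_linear_onD(2)[OF L mem mem mem, of x y "Suc y"] Suc.prems by auto
    qed (use step in simp)
  qed simp
  have irr: "\<not> L (\<sigma> i) (\<sigma> i)" using strict_linear_onD(1)[OF L] mem i by blast
  have "\<not> L (\<sigma> i) (\<sigma> j)" if "j < i"
    using less[of j i] that i j irr strict_linear_onD(2)[OF L mem mem mem, of i j i] by auto
  then show ?thesis using less[of i j] i j irr
    by (metis atLeastAtMost_iff linorder_neqE_nat)
qed

text \<open>So \<open>inv \<sigma>\<close> ranks the elements by \<open>L\<close>: comparisons in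
  the order become comparisons of positions, which later lets a permutation stand in for the
  order.\<close>

lemma sorts_inv_less_iff:
  assumes L: "strict_linear_on {1..n} L" and s: "sorts n L \<sigma>"
    and a: "a \<in> {1..n}" and b: "b \<in> {1..n}"
  shows "inv \<sigma> a < inv \<sigma> b \<longleftrightarrow> L a b"
proof -
  have p: "\<sigma> permutes {1..n}" using s unfolding sorts_def by blast
  have "inv \<sigma> a \<in> {1..n}" "inv \<sigma> b \<in> {1..n}"
    using permutes_in_image[OF permutes_inv[OF p]] a b by auto
  from sorts_less_iff[OF L s this] show ?thesis
    by (simp add: permutes_inverses(1)[OF p])
qed

lemma sorts_inv_eq_rank:
  assumes L: "strict_linear_on {1..n} L" and s: "sorts n L \<sigma>" and a: "a \<in> {1..n}"
  shows "inv \<sigma> a = Suc (card {b\<in>{1..n}. L b a})"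
proof -
  have p: "\<sigma> permutes {1..n}" using s unfolding sorts_def by blast
  have ia: "inv \<sigma> a \<in> {1..n}" using permutes_in_image[OF permutes_inv[OF p]] a by auto
  have "{b\<in>{1..n}. L b a} = \<sigma> ` {1..<inv \<sigma> a}"
  proof (intro equalityI subsetI)
    fix b assume "b \<in> {b\<in>{1..n}. L b a}"
    then have b: "b \<in> {1..n}" "inv \<sigma> b < inv \<sigma> a"
      using sorts_inv_less_iff[OF L s _ a] by auto
    moreover have "inv \<sigma> b \<in> {1..n}" using permutes_in_image[OF permutes_inv[OF p]] b by auto
    ultimately show "b \<in> \<sigma> ` {1..<inv \<sigma> a}"
      by (intro image_eqI[of _ _ "inv \<sigma> b"]) (auto simp: permutes_inverses[OF p])
  next
    fix b assume "b \<in> \<sigma> ` {1..<inv \<sigma> a}"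
    then obtain c where c: "b = \<sigma> c" "1 \<le> c" "c < inv \<sigma> a" by auto
    then have "b \<in> {1..n}" using ia permutes_in_image[OF p, of c] by auto
    then show "b \<in> {b\<in>{1..n}. L b a}"
      using c sorts_inv_less_iff[OF L s _ a, of b] by (auto simp: permutes_inverses[OF p])
  qed
  then have "card {b\<in>{1..n}. L b a} = inv \<sigma> a - 1"
    using card_image[OF inj_on_subset[OF permutes_inj[OF p] subset_UNIV]] by simp
  then show ?thesis using ia by simp
qed

text \<open>The inverse of a sorting permutation is the rank function, which mentions
  \<open>L\<close> only.\<close>

lemma sorts_unique:
  assumes L: "strict_linear_on {1..n} L" and s: "sorts n L \<sigma>" and t: "sorts n L \<tau>"
  shows "\<sigma> = \<tau>"
proof -
  have p: "\<sigma> permutes {1..n}" "\<tau> permutes {1..n}" using s t unfolding sorts_def by blast+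
  have "inv \<sigma> a = inv \<tau> a" for a
  proof (cases "a \<in> {1..n}")
    case True
    then show ?thesis using sorts_inv_eq_rank[OF L s] sorts_inv_eq_rank[OF L t] by simp
  next
    case False
    then show ?thesis using permutes_inv[OF p(1)] permutes_inv[OF p(2)]
      by (metis permutes_not_in)
  qed
  then have "inv \<sigma> = inv \<tau>" by blast
  then show ?thesis using p permutes_inv_inv by metis
qed

text \<open>The rank function is injective from a finite set to itself, hence a permutation, and its
  inverse sorts.\<close>

lemma sorts_exists:
  assumes L: "strict_linear_on {1..n} L"
  shows "\<exists>\<sigma>. sorts n L \<sigma>"
proof -
  \<comment> \<open>This is to be the inverse of the sorting permutation; outside
    \<open>{1..n}\<close> it is the identity, as \<open>permutes\<close> demands.\<close>
  define r where "r a = (if a \<in> {1..n} then Suc (card {b\<in>{1..n}. L b a}) else a)" for a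
  have mono: "r a < r b" if "a \<in> {1..n}" "b \<in> {1..n}" "L a b" for a b
  proof -
    have "{c\<in>{1..n}. L c a} \<subseteq> {c\<in>{1..n}. L c b}"
      using that strict_linear_onD(2)[OF L, of _ a b] by auto
    moreover have "a \<in> {c\<in>{1..n}. L c b}" "a \<notin> {c\<in>{1..n}. L c a}"
      using that strict_linear_onD(1)[OF L] by auto
    ultimately have "{c\<in>{1..n}. L c a} \<subset> {c\<in>{1..n}. L c b}" by blast
    then show ?thesis using that unfolding r_def by (simp add: psubset_card_mono)
  qed
  have inj: "inj_on r {1..n}"
    using mono strict_linear_onD(3)[OF L] by (metis inj_onI less_irrefl_nat)
  have "r a \<in> {1..n}" if "a \<in> {1..n}" for a
  proof -
    have "{c\<in>{1..n}. L c a} \<subset> {1..n}" using that strict_linear_onD(1)[OF L] by blast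
    then have "card {c\<in>{1..n}. L c a} < card {1..n}" by (intro psubset_card_mono) auto
    then show ?thesis using that unfolding r_def by simp
  qed
  then have "bij_betw r {1..n} {1..n}"
    unfolding bij_betw_def using inj endo_inj_surj[OF _ _ inj] by blast
  then have p: "r permutes {1..n}" by (rule bij_imp_permutes) (auto simp: r_def)
  have "L (inv r i) (inv r (i + 1))" if "i \<in> {1..<n}" for i
  proof -
    have m: "inv r i \<in> {1..n}" "inv r (i + 1) \<in> {1..n}"
      using that permutes_in_image[OF permutes_inv[OF p]] by auto
    have "r (inv r i) < r (inv r (i + 1))" by (simp add: permutes_inverses[OF p])
    then show ?thesis using mono m strict_linear_onD(3)[OF L m]
      by (metis less_asym' less_irrefl_nat)
  qed
  then show ?thesis using permutes_inv[OF p] unfolding sorts_def by blast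
qed

section \<open>Lexicographic order refined by a tie-break\<close>

lemma lexless_irrefl: "\<not> lexless xs xs"
  by (induction xs) auto

lemma lexless_trans: "lexless xs ys \<Longrightarrow> lexless ys zs \<Longrightarrow> lexless xs zs"
  by (induction xs ys arbitrary: zs rule: lexless.induct) (case_tac zs; auto)+

text \<open>Equal lengths matter: \<open>lexless\<close> relates a list and a proper prefix of it in
  neither direction.\<close>

lemma lexless_total: "length xs = length ys \<Longrightarrow> xs \<noteq> ys \<Longrightarrow> lexless xs ys \<or> lexless ys xs"
  by (induction xs ys rule: list_induct2) auto

text \<open>The order on positions hidden in the tie cases of \<open>Des\<close>: the classes of
  \<open>simR R\<close> keep their natural order, while the elements inside one class are
  reversed.\<close>

definition tie_less :: "nat set \<Rightarrow> nat \<Rightarrow> nat \<Rightarrow> bool" where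
  "tie_less R a b \<longleftrightarrow> a < b \<and> \<not> simR R a b \<or> b < a \<and> simR R b a"

text \<open>The classes of \<open>simR R\<close> are intervals, numbered by how many non-elements of \<open>R\<close> lie below
  them.\<close>

lemma tie_less_iff:
  "tie_less R a b \<longleftrightarrow> card ({..<a} - R) < card ({..<b} - R) \<or>
     card ({..<a} - R) = card ({..<b} - R) \<and> b < a"
proof -
  have *: "card ({..<b} - R) = card ({..<a} - R) + card ({a..<b} - R)" if "a \<le> b" for a b
  proof -
    have "{..<b} - R = ({..<a} - R) \<union> ({a..<b} - R)" using that by auto
    then show ?thesis by (simp add: card_Un_disjoint disjoint_iff)
  qed
  \<comment> \<open>The two elements lie in different classes iff some element missing from
    \<open>R\<close> separates them, and by \<open>*\<close> this is when their class numbers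
    differ.\<close>
  have 2: "\<not> simR R a b \<longleftrightarrow> 0 < card ({a..<b} - R)" if "a < b" for a b
    using that unfolding simR_def by (auto simp: card_gt_0_iff)
  show ?thesis
  proof (cases a b rule: linorder_cases)
    case less
    then show ?thesis unfolding tie_less_def using *[of a b] 2[of a b] by (auto simp del: card_0_eq)
  next
    case greater
    then show ?thesis unfolding tie_less_def using *[of b a] 2[of b a] by (auto simp del: card_0_eq)
  qed (simp add: tie_less_def)
qed

definition key_less :: "nat set \<Rightarrow> (nat \<Rightarrow> nat list) \<Rightarrow> nat \<Rightarrow> nat \<Rightarrow> bool" where
  "key_less R S a b \<longleftrightarrow> lexless (S a) (S b) \<or> S a = S b \<and> tie_less R a b"

text \<open>By \<open>tie_less_iff\<close>, ties are resolved by comparing class numbers and then,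
  in reverse, the labels; the common length makes \<open>lexless\<close> total on distinct
  entries.\<close>

lemma strict_linear_on_key_less:
  assumes "\<And>a. a \<in> A \<Longrightarrow> length (S a) = r"
  shows "strict_linear_on A (key_less R S)"
  unfolding strict_linear_on_def
proof (intro conjI)
  show "irreflp_on A (key_less R S)"
    by (auto intro!: irreflp_onI simp: key_less_def tie_less_iff lexless_irrefl)
  show "transp_on A (key_less R S)"
    by (rule transp_onI) (auto simp: key_less_def tie_less_iff intro: lexless_trans)
  show "totalp_on A (key_less R S)"
  proof (rule totalp_onI)
    fix a b assume "a \<in> A" "b \<in> A" "a \<noteq> b"
    then show "key_less R S a b \<or> key_less R S b a"
      using lexless_total[of "S a" "S b"] assms unfolding key_less_def tie_less_iff
      by (cases "S a = S b") auto
  qed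
qed

section \<open>Descents as adjacent inversions of the refined order\<close>

lemma Des_eq: "Des R n S \<sigma> = {i\<in>{1..<n}. key_less R S (\<sigma> (i + 1)) (\<sigma> i)}"
  unfolding Des_def key_less_def tie_less_def by (auto simp: eq_commute)

text \<open>The ordinary descent set of the permutation \<open>inv \<rho> \<circ> \<sigma>\<close>;
  \<open>inv_comaj\<close> is its comajor index.\<close>

definition inv_Des :: "nat \<Rightarrow> (nat \<Rightarrow> nat) \<Rightarrow> (nat \<Rightarrow> nat) \<Rightarrow> nat set" where
  "inv_Des n \<rho> \<sigma> = {i\<in>{1..<n}. inv \<rho> (\<sigma> (i + 1)) < inv \<rho> (\<sigma> i)}"

definition inv_comaj :: "nat \<Rightarrow> (nat \<Rightarrow> nat) \<Rightarrow> (nat \<Rightarrow> nat) \<Rightarrow> nat" where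
  "inv_comaj n \<rho> \<sigma> = (\<Sum>d\<in>inv_Des n \<rho> \<sigma>. n - d)"

text \<open>All that \<open>Des\<close> needs to know about \<open>R\<close> and \<open>S\<close> is
  contained in the permutation sorting \<open>S\<close>.\<close>

lemma Des_eq_inv_Des:
  assumes "\<And>a. a \<in> {1..n} \<Longrightarrow> length (S a) = r" "sorts n (key_less R S) \<rho>" "\<sigma> permutes {1..n}"
  shows "Des R n S \<sigma> = inv_Des n \<rho> \<sigma>"
proof -
  have "\<sigma> i \<in> {1..n}" if "i \<in> {1..n}" for i
    using permutes_in_image[OF assms(3)] that by blast
  then show ?thesis
    using sorts_inv_less_iff[OF strict_linear_on_key_less[OF assms(1)] assms(2)]
    unfolding Des_eq inv_Des_def by auto
qed

text \<open>The prepended coordinate is most significant and the old order only breaks its ties. So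
  neighbours in the old order may agree in \<open>x\<close>, while neighbours inverted by the old
  order, the descents, must differ.\<close>

lemma sorts_key_less_Cons_iff:
  assumes S: "\<And>a. a \<in> {1..n} \<Longrightarrow> length (S a) = r" and \<rho>: "sorts n (key_less R S) \<rho>"
    and \<sigma>: "\<sigma> permutes {1..n}" and S': "\<And>a. a \<in> {1..n} \<Longrightarrow> S' a = x a # S a"
  shows "sorts n (key_less R S') \<sigma> \<longleftrightarrow>
    (\<forall>i\<in>{1..<n}. x (\<sigma> i) \<le> x (\<sigma> (i + 1)) \<and> (i \<in> inv_Des n \<rho> \<sigma> \<longrightarrow> x (\<sigma> i) < x (\<sigma> (i + 1))))"
proof -
  have "key_less R S' (\<sigma> i) (\<sigma> (i + 1)) \<longleftrightarrow>
      x (\<sigma> i) \<le> x (\<sigma> (i + 1)) \<and> (i \<in> inv_Des n \<rho> \<sigma> \<longrightarrow> x (\<sigma> i) < x (\<sigma> (i + 1)))"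
    if i: "i \<in> {1..<n}" for i
  proof -
    have m: "\<sigma> i \<in> {1..n}" "\<sigma> (i + 1) \<in> {1..n}"
      using i permutes_in_image[OF \<sigma>] by auto
    have ne: "\<sigma> i \<noteq> \<sigma> (i + 1)" by (simp add: inj_eq[OF permutes_inj[OF \<sigma>]])
    have "i \<in> inv_Des n \<rho> \<sigma> \<longleftrightarrow> \<not> key_less R S (\<sigma> i) (\<sigma> (i + 1))"
      using strict_linear_on_not_iff[OF strict_linear_on_key_less[OF S] m ne]
        Des_eq_inv_Des[OF S \<rho> \<sigma>] i unfolding Des_eq by auto
    moreover have "key_less R S' (\<sigma> i) (\<sigma> (i + 1)) \<longleftrightarrow> x (\<sigma> i) < x (\<sigma> (i + 1)) \<or>
        x (\<sigma> i) = x (\<sigma> (i + 1)) \<and> key_less R S (\<sigma> i) (\<sigma> (i + 1))"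
      unfolding key_less_def S'[OF m(1)] S'[OF m(2)] by auto
    ultimately show ?thesis by auto
  qed
  then show ?thesis using \<sigma> unfolding sorts_def by blast
qed

text \<open>Absence of descents means being sorted, so the description in \<open>tauR_def\<close>
  singles out the unique sorting permutation of the tuple of empty lists.\<close>

lemma sorts_tauR: "sorts n (key_less R (\<lambda>_. [])) (tauR R n)"
proof -
  let ?L = "key_less R (\<lambda>_. [])"
  have L: "strict_linear_on {1..n} ?L"
    by (rule strict_linear_on_key_less[of _ _ 0]) simp
  have iff: "\<sigma> permutes {1..n} \<and> Comaj R n (\<lambda>j. []) \<sigma> = 0 \<longleftrightarrow> sorts n ?L \<sigma>" for \<sigma>
  proof (cases "\<sigma> permutes {1..n}")
    case p: True
    have "?L (\<sigma> i) (\<sigma> (i + 1)) \<longleftrightarrow> \<not> ?L (\<sigma> (i + 1)) (\<sigma> i)" if i: "i \<in> {1..<n}" for i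
    proof -
      have "\<sigma> i \<in> {1..n}" "\<sigma> (i + 1) \<in> {1..n}" using i permutes_in_image[OF p] by auto
      moreover have "\<sigma> (i + 1) \<noteq> \<sigma> i" by (simp add: inj_eq[OF permutes_inj[OF p]])
      ultimately show ?thesis using strict_linear_on_not_iff[OF L] by blast
    qed
    then have "sorts n ?L \<sigma> \<longleftrightarrow> Des R n (\<lambda>_. []) \<sigma> = {}"
      using p unfolding sorts_def Des_eq by auto
    \<comment> \<open>Every descent \<open>i\<close> is below \<open>n\<close> and so contributes a
      positive \<open>n - i\<close>.\<close>
    also have "\<dots> \<longleftrightarrow> Comaj R n (\<lambda>_. []) \<sigma> = 0"
      unfolding Comaj_def by (auto simp: Des_eq)
    finally show ?thesis using p by simp
  qed (simp add: sorts_def)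
  have "\<exists>!\<sigma>. sorts n ?L \<sigma>" using sorts_exists[OF L] sorts_unique[OF L] by blast
  then show ?thesis unfolding tauR_def iff by (rule theI')
qed

text \<open>Read along \<open>\<sigma>\<close>, the prepended coordinate counts the descents passed
  so far; it is therefore weakly increasing and jumps at each descent.\<close>

lemma Zmap_sorts:
  assumes S: "\<And>a. a \<in> {1..n} \<Longrightarrow> length (S a) = r" and \<rho>: "sorts n (key_less R S) \<rho>"
    and \<sigma>: "\<sigma> permutes {1..n}"
  shows "sorts n (key_less R (Zmap R n \<sigma> S)) \<sigma>"
proof -
  let ?x = "\<lambda>j. card {d\<in>Des R n S \<sigma>. d < inv \<sigma> j}"
  have fin: "finite (Des R n S \<sigma>)" unfolding Des_def by simp
  have "?x (\<sigma> i) \<le> ?x (\<sigma> (i + 1)) \<and> (i \<in> inv_Des n \<rho> \<sigma> \<longrightarrow> ?x (\<sigma> i) < ?x (\<sigma> (i + 1)))" for i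
  proof (intro conjI impI)
    show "?x (\<sigma> i) \<le> ?x (\<sigma> (i + 1))"
      by (rule card_mono) (use fin in \<open>auto simp: permutes_inverses[OF \<sigma>]\<close>)
    assume "i \<in> inv_Des n \<rho> \<sigma>"
    then have "i \<in> Des R n S \<sigma>" using Des_eq_inv_Des[OF S \<rho> \<sigma>] by simp
    then show "?x (\<sigma> i) < ?x (\<sigma> (i + 1))"
      by (intro psubset_card_mono) (use fin in \<open>auto simp: permutes_inverses[OF \<sigma>]\<close>)
  qed
  then show ?thesis
    using sorts_key_less_Cons_iff[OF S \<rho> \<sigma>, of "Zmap R n \<sigma> S" ?x] unfolding Zmap_def by blast
qed

section \<open>The iterated tuples and their comajor indices\<close>

lemma length_Zit: "length (Zit R n \<pi> i j) = i"
  by (induction i) (auto simp: Zmap_def)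

text \<open>The value at \<open>0\<close> is overwritten because the tuple of empty lists is sorted
  by \<open>tauR R n\<close>, whatever \<open>\<pi> 0\<close> is.\<close>

lemma Zit_sorts:
  assumes "\<And>j. j \<in> {1..i} \<Longrightarrow> \<pi> j permutes {1..n}"
  shows "sorts n (key_less R (Zit R n \<pi> i)) ((\<pi>(0 := tauR R n)) i)"
  using assms
proof (induction i)
  case (Suc i)
  then have "sorts n (key_less R (Zit R n \<pi> i)) ((\<pi>(0 := tauR R n)) i)" by simp
  from Zmap_sorts[OF _ this, of i "\<pi> (Suc i)"] Suc.prems[of "Suc i"] show ?case
    by (simp add: length_Zit)
qed (use sorts_tauR in simp)

text \<open>The tuple with both ends supplied: \<open>tauR\<close> sorts the empty tails, and
  \<open>id\<close> is the convention for the last permutation. The update at \<open>k\<close> takes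
  precedence, so \<open>k = 0\<close> would give \<open>id\<close> at \<open>0\<close>.\<close>

definition full_tuple :: "nat set \<Rightarrow> nat \<Rightarrow> nat \<Rightarrow> (nat \<Rightarrow> nat \<Rightarrow> nat) \<Rightarrow> nat \<Rightarrow> nat \<Rightarrow> nat" where
  "full_tuple R n k \<pi> = \<pi>(0 := tauR R n, k := id)"

lemma full_tuple_permutes:
  assumes "\<pi> \<in> perm_tuples n k" "i \<le> k"
  shows "full_tuple R n k \<pi> i permutes {1..n}"
  using assms sorts_tauR[of n R] unfolding full_tuple_def perm_tuples_def sorts_def
  by (auto simp: permutes_id)

text \<open>By construction \<open>\<pi>\<^sup>i\<close> sorts \<open>Z\<^sup>i\<close>, so the comajor indices only see the quotients of
  consecutive permutations.\<close>

lemma comaj_eq_inv_comaj: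
  assumes \<pi>: "\<And>j. j \<in> {1..<k} \<Longrightarrow> \<pi> j permutes {1..n}" and i: "i \<in> {1..k}"
  shows "comaj R n k \<pi> i = inv_comaj n (full_tuple R n k \<pi> (i - 1)) (full_tuple R n k \<pi> i)"
proof -
  let ?\<pi> = "\<pi>(k := id)"
  have p: "?\<pi> j permutes {1..n}" if "j \<in> {1..k}" for j
    using \<pi> that by (auto simp: permutes_id)
  then have "sorts n (key_less R (Zit R n ?\<pi> (i - 1))) ((?\<pi>(0 := tauR R n)) (i - 1))"
    using i by (intro Zit_sorts p) auto
  from Des_eq_inv_Des[OF _ this p[OF i]] length_Zit
  have "Des R n (Zit R n ?\<pi> (i - 1)) (?\<pi> i) = inv_Des n ((?\<pi>(0 := tauR R n)) (i - 1)) (?\<pi> i)"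
    by blast
  moreover have "(?\<pi>(0 := tauR R n)) (i - 1) = full_tuple R n k \<pi> (i - 1)"
    "?\<pi> i = full_tuple R n k \<pi> i"
    using i unfolding full_tuple_def by auto
  ultimately show ?thesis
    unfolding comaj_def Comaj_def inv_comaj_def Let_def by simp
qed

section \<open>Sequences increasing along a descent set\<close>

text \<open>The possible values of one coordinate once read in sorted order, with \<open>D\<close>
  the descents that force a strict rise. Vanishing outside \<open>{1..n}\<close> makes each finite
  sequence a single function, so that \<open>card\<close> counts sequences.\<close>

definition inc_seqs :: "nat \<Rightarrow> nat set \<Rightarrow> nat \<Rightarrow> (nat \<Rightarrow> nat) set" where
  "inc_seqs n D m = {y. (\<forall>i. i \<notin> {1..n} \<longrightarrow> y i = 0) \<and>
     (\<forall>i\<in>{1..<n}. y i \<le> y (i + 1) \<and> (i \<in> D \<longrightarrow> y i < y (i + 1))) \<and> (\<Sum>i=1..n. y i) = m}"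

lemma inc_seqs_ge:
  assumes D: "D \<subseteq> {1..<n}" and y: "y \<in> inc_seqs n D m" and i: "1 \<le> i" "i \<le> n"
  shows "y 1 + card {d\<in>D. d < i} \<le> y i"
  using i
proof (induction i rule: dec_induct)
  case base
  have "{d\<in>D. d < 1} = {}" using D by auto
  then show ?case by simp
next
  case (step i)
  have fin: "finite D" using D finite_subset by blast
  have "card {d\<in>D. d < Suc i} = card {d\<in>D. d < i} + (if i \<in> D then 1 else 0)"
  proof -
    have "{d\<in>D. d < Suc i} = (if i \<in> D then insert i {d\<in>D. d < i} else {d\<in>D. d < i})"
      by (auto simp: less_Suc_eq)
    then show ?thesis using fin by simp
  qed
  moreover have "y i \<le> y (i + 1) \<and> (i \<in> D \<longrightarrow> y i < y (i + 1))"
    using y step unfolding inc_seqs_def by auto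
  ultimately show ?case using step by auto
qed

text \<open>Double counting of the pairs \<open>d < i\<close>: each \<open>d\<close> lies below
  \<open>n - d\<close> positions.\<close>

lemma sum_card_less:
  assumes D: "D \<subseteq> {1..<n::nat}"
  shows "(\<Sum>i=1..n. card {d\<in>D. d < i}) = (\<Sum>d\<in>D. n - d)"
proof -
  have fin: "finite D" using D finite_subset by blast
  have "(\<Sum>i=1..n. card {d\<in>D. d < i}) = (\<Sum>i=1..n. \<Sum>d\<in>D. of_bool (d < i))"
    using fin by (intro sum.cong) (simp_all add: Int_def)
  also have "\<dots> = (\<Sum>d\<in>D. \<Sum>i=1..n. of_bool (d < i))"
    by (rule sum.swap)
  also have "\<dots> = (\<Sum>d\<in>D. n - d)"
  proof (rule sum.cong)
    fix d assume "d \<in> D"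
    have "{1..n} \<inter> {i. d < i} = {d<..n}" by auto
    then show "(\<Sum>i=1..n. of_bool (d < i)) = n - d" by simp
  qed simp
  finally show ?thesis .
qed

text \<open>Subtracting the least sequence with strict rises along \<open>D\<close> turns these
  rises into weak ones and lowers the sum by the comajor index of \<open>D\<close>.\<close>

lemma card_inc_seqs_shift:
  assumes D: "D \<subseteq> {1..<n}"
  shows "card (inc_seqs n D (l + (\<Sum>d\<in>D. n - d))) = card (inc_seqs n {} l)"
proof -
  define z where "z i = (if i \<in> {1..n} then card {d\<in>D. d < i} else 0)" for i
  have fin: "finite D" using D finite_subset by blast
  have zSuc: "z (i + 1) = z i + of_bool (i \<in> D)" if "i \<in> {1..<n}" for i
  proof -
    have "{d\<in>D. d < Suc i} = (if i \<in> D then insert i {d\<in>D. d < i} else {d\<in>D. d < i})"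
      by (auto simp: less_Suc_eq)
    then show ?thesis using fin that by (simp add: z_def)
  qed
  have zsum: "(\<Sum>i=1..n. z i) = (\<Sum>d\<in>D. n - d)"
    unfolding sum_card_less[OF D, symmetric] by (rule sum.cong) (auto simp: z_def)
  have zle: "z i \<le> y i" if "y \<in> inc_seqs n D m" for y m i
    using inc_seqs_ge[OF D that, of i] by (auto simp: z_def)
  have "bij_betw (\<lambda>y i. y i + z i) (inc_seqs n {} l) (inc_seqs n D (l + (\<Sum>d\<in>D. n - d)))"
  proof (rule bij_betw_byWitness[where f' = "\<lambda>y i. y i - z i"])
    show "(\<lambda>y i. y i + z i) ` inc_seqs n {} l \<subseteq> inc_seqs n D (l + (\<Sum>d\<in>D. n - d))"
    proof safe
      fix y assume y: "y \<in> inc_seqs n {} l"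
      have "(\<Sum>i=1..n. y i + z i) = l + (\<Sum>d\<in>D. n - d)"
        using y unfolding sum.distrib zsum by (simp add: inc_seqs_def)
      moreover have "y i + z i = 0" if "i \<notin> {1..n}" for i
        using y that by (auto simp: inc_seqs_def z_def)
      moreover have "y i + z i \<le> y (i + 1) + z (i + 1) \<and>
          (i \<in> D \<longrightarrow> y i + z i < y (i + 1) + z (i + 1))" if i: "i \<in> {1..<n}" for i
      proof -
        have "y i \<le> y (i + 1)" using y i unfolding inc_seqs_def by blast
        then show ?thesis using zSuc[OF i] by auto
      qed
      ultimately show "(\<lambda>i. y i + z i) \<in> inc_seqs n D (l + (\<Sum>d\<in>D. n - d))"
        unfolding inc_seqs_def by blast
    qed
    show "(\<lambda>y i. y i - z i) ` inc_seqs n D (l + (\<Sum>d\<in>D. n - d)) \<subseteq> inc_seqs n {} l"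
    proof safe
      fix y assume y: "y \<in> inc_seqs n D (l + (\<Sum>d\<in>D. n - d))"
      have "(\<Sum>i=1..n. y i - z i) = (\<Sum>i=1..n. y i) - (\<Sum>i=1..n. z i)"
        using zle[OF y] by (intro sum_subtractf_nat) auto
      also have "\<dots> = l" using y zsum by (simp add: inc_seqs_def)
      finally have "(\<Sum>i=1..n. y i - z i) = l" .
      moreover have "y i - z i \<le> y (i + 1) - z (i + 1)" if i: "i \<in> {1..<n}" for i
      proof -
        have "y i \<le> y (i + 1) \<and> (i \<in> D \<longrightarrow> y i < y (i + 1))"
          using y i unfolding inc_seqs_def by blast
        then show ?thesis using zSuc[OF i] by auto
      qed
      ultimately show "(\<lambda>i. y i - z i) \<in> inc_seqs n {} l"
        using y by (auto simp: inc_seqs_def)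
    qed
  qed (use zle in \<open>auto simp: fun_eq_iff\<close>)
  then show ?thesis by (simp add: bij_betw_same_card)
qed

lemma inc_seqs_empty:
  assumes D: "D \<subseteq> {1..<n}" and m: "m < (\<Sum>d\<in>D. n - d)"
  shows "inc_seqs n D m = {}"
proof (rule equals0I)
  fix y assume y: "y \<in> inc_seqs n D m"
  have "(\<Sum>i=1..n. card {d\<in>D. d < i}) \<le> (\<Sum>i=1..n. y i)"
    using inc_seqs_ge[OF D y] by (intro sum_mono) (meson add_leD2 atLeastAtMost_iff)
  then show False using m y unfolding sum_card_less[OF D] by (simp add: inc_seqs_def)
qed

lemma finite_inc_seqs: "finite (inc_seqs n D m)"
proof -
  have "inc_seqs n D m \<subseteq> {y. \<forall>i. (i \<in> {1..n} \<longrightarrow> y i \<in> {..m}) \<and> (i \<notin> {1..n} \<longrightarrow> y i = 0)}"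
    by (auto simp: inc_seqs_def intro!: member_le_sum)
  then show ?thesis
    using finite_set_of_finite_funs[of "{1..n}" "{..m}" 0] finite_subset by blast
qed

section \<open>Generating function of the increasing sequences\<close>

lemma card_inc_seqs_0: "card (inc_seqs 0 {} m) = of_bool (m = 0)"
proof -
  have "inc_seqs 0 {} m = (if m = 0 then {\<lambda>_. 0} else {})"
    by (auto simp: inc_seqs_def fun_eq_iff)
  then show ?thesis by simp
qed

text \<open>A sequence either starts with \<open>0\<close>, which may be dropped, or all its entries may be lowered
  by \<open>1\<close>.\<close>

lemma card_inc_seqs_Suc:
  "card (inc_seqs (Suc n) {} m) = card (inc_seqs n {} m) +
     (if Suc n \<le> m then card (inc_seqs (Suc n) {} (m - Suc n)) else 0)"
proof -
  let ?A = "{y\<in>inc_seqs (Suc n) {} m. y 1 = 0}" and ?B = "{y\<in>inc_seqs (Suc n) {} m. 0 < y 1}"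
  have "inc_seqs (Suc n) {} m = ?A \<union> ?B" by auto
  then have "card (inc_seqs (Suc n) {} m) = card ?A + card ?B"
    using finite_inc_seqs[of "Suc n" "{}" m] by (subst card_Un_disjoint[symmetric]) auto
  moreover have "card ?A = card (inc_seqs n {} m)"
  proof -
    have sum: "(\<Sum>i=1..Suc n. y i) = y 1 + (\<Sum>i=1..n. y (Suc i))" for y :: "nat \<Rightarrow> nat"
      by (simp add: sum.atLeast_Suc_atMost sum.shift_bounds_cl_Suc_ivl del: sum.cl_ivl_Suc)
    \<comment> \<open>Truncated subtraction sends both \<open>0\<close> and \<open>1\<close> to
      \<open>0\<close>, so the new first entry is \<open>y 0\<close>, which is
      \<open>0\<close>.\<close>
    have "bij_betw (\<lambda>y i. y (i - 1)) (inc_seqs n {} m) ?A"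
    proof (rule bij_betw_byWitness[where f' = "\<lambda>y i. if i = 0 then 0 else y (Suc i)"])
      show "(\<lambda>y i. y (i - 1)) ` inc_seqs n {} m \<subseteq> ?A"
      proof safe
        fix y assume y: "y \<in> inc_seqs n {} m"
        have "y (i - 1) \<le> y i" if "i \<in> {1..<Suc n}" for i
        proof (cases "i = 1")
          case False
          then have "i - 1 \<in> {1..<n}" using that by auto
          then have "y (i - 1) \<le> y (i - 1 + 1)" using y unfolding inc_seqs_def by blast
          then show ?thesis using that by simp
        qed (use y in \<open>simp add: inc_seqs_def\<close>)
        moreover have "(\<Sum>i=1..Suc n. y (i - 1)) = m"
          unfolding sum using y by (simp add: inc_seqs_def)
        moreover have "y (i - 1) = 0" if "i \<notin> {1..Suc n}" for i
        proof -
          have "i - 1 \<notin> {1..n}" using that by auto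
          then show ?thesis using y unfolding inc_seqs_def by blast
        qed
        ultimately show "(\<lambda>i. y (i - 1)) \<in> inc_seqs (Suc n) {} m"
          unfolding inc_seqs_def mem_Collect_eq by (simp only: add_diff_cancel_right') blast
      qed (simp add: inc_seqs_def)
      show "(\<lambda>y i. if i = 0 then 0 else y (Suc i)) ` ?A \<subseteq> inc_seqs n {} m"
      proof safe
        fix y assume y: "y \<in> inc_seqs (Suc n) {} m" "y 1 = 0"
        have "(\<Sum>i=1..n. if i = 0 then 0 else y (Suc i)) = (\<Sum>i=1..n. y (Suc i))"
          by (intro sum.cong) auto
        also have "\<dots> = m" using y sum[of y] unfolding inc_seqs_def by simp
        finally show "(\<lambda>i. if i = 0 then 0 else y (Suc i)) \<in> inc_seqs n {} m"
          using y unfolding inc_seqs_def by auto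
      qed
      show "\<forall>y\<in>?A. (\<lambda>i. (if i - 1 = 0 then 0 else y (Suc (i - 1)))) = y"
      proof (intro ballI ext)
        fix y i assume "y \<in> ?A"
        then show "(if i - 1 = 0 then 0 else y (Suc (i - 1))) = y i"
          by (cases "i \<le> 1") (auto simp: inc_seqs_def le_Suc_eq)
      qed
    qed (auto simp: inc_seqs_def fun_eq_iff)
    then show ?thesis by (simp add: bij_betw_same_card)
  qed
  moreover have "card ?B = (if Suc n \<le> m then card (inc_seqs (Suc n) {} (m - Suc n)) else 0)"
  proof -
    have pos: "1 \<le> y i" if "y \<in> ?B" "i \<in> {1..Suc n}" for y i
      using inc_seqs_ge[of "{}" "Suc n" y m i] that by simp
    show ?thesis
    proof (cases "Suc n \<le> m")
      case True
      \<comment> \<open>Only the entries in \<open>{1..Suc n}\<close> are raised; those outside have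
        to stay \<open>0\<close>.\<close>
      let ?up = "\<lambda>y i. if i \<in> {1..Suc n} then y i + 1 else (0::nat)"
      have "bij_betw ?up (inc_seqs (Suc n) {} (m - Suc n)) ?B"
      proof (rule bij_betw_byWitness[where f' = "\<lambda>y i. y i - 1"])
        show "?up ` inc_seqs (Suc n) {} (m - Suc n) \<subseteq> ?B"
        proof safe
          fix y assume y: "y \<in> inc_seqs (Suc n) {} (m - Suc n)"
          have "(\<Sum>i=1..Suc n. ?up y i) = (\<Sum>i=1..Suc n. y i + 1)"
            by (intro sum.cong) auto
          also have "\<dots> = m"
            using y True by (simp only: sum.distrib) (simp add: inc_seqs_def)
          finally show "?up y \<in> inc_seqs (Suc n) {} m"
            using y unfolding inc_seqs_def by auto
        qed simp
        show "(\<lambda>y i. y i - 1) ` ?B \<subseteq> inc_seqs (Suc n) {} (m - Suc n)"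
        proof (rule image_subsetI)
          fix y assume y: "y \<in> ?B"
          have "(\<Sum>i=1..Suc n. y i - 1) = (\<Sum>i=1..Suc n. y i) - (\<Sum>i=1..Suc n. 1)"
            using pos[OF y] by (intro sum_subtractf_nat) auto
          also have "\<dots> = m - Suc n" using y by (simp add: inc_seqs_def)
          finally show "(\<lambda>i. y i - 1) \<in> inc_seqs (Suc n) {} (m - Suc n)"
            using y unfolding inc_seqs_def by (auto intro: diff_le_mono)
        qed
        show "\<forall>y\<in>?B. ?up (\<lambda>i. y i - 1) = y"
        proof (intro ballI ext)
          fix y i assume "y \<in> ?B"
          then show "?up (\<lambda>i. y i - 1) i = y i"
            using pos[of y i] by (auto simp: inc_seqs_def)
        qed
      qed (auto simp: inc_seqs_def fun_eq_iff)
      then show ?thesis using True by (simp add: bij_betw_same_card)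
    next
      case False
      have "?B = {}"
      proof (rule equals0I)
        fix y assume y: "y \<in> ?B"
        have "(\<Sum>i=1..Suc n. 1) \<le> (\<Sum>i=1..Suc n. y i)"
          by (rule sum_mono) (rule pos[OF y])
        then show False using False y by (simp add: inc_seqs_def)
      qed
      then show ?thesis using False by (metis card.empty)
    qed
  qed
  ultimately show ?thesis by simp
qed

text \<open>The recursion \<open>card_inc_seqs_Suc\<close> says that multiplying the series for
  \<open>Suc n\<close> by \<open>1 - fps_X ^ Suc n\<close> gives the series for \<open>n\<close>,
  and these factors build up \<open>qpoch\<close>.\<close>

lemma inc_seqs_gf:
  "Abs_fps (\<lambda>m. int (card (inc_seqs n {} m))) * fps_of_poly (qpoch n) = 1"
proof (induction n)
  case 0
  show ?case by (simp add: fps_eq_iff card_inc_seqs_0 qpoch_def)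
next
  case (Suc n)
  let ?G = "\<lambda>n. Abs_fps (\<lambda>m. int (card (inc_seqs n {} m)))"
  have G: "?G (Suc n) * (1 - fps_X ^ Suc n) = ?G n"
  proof (rule fps_ext)
    fix m
    have "?G (Suc n) * (1 - fps_X ^ Suc n) = ?G (Suc n) - fps_X ^ Suc n * ?G (Suc n)"
      by (simp add: algebra_simps)
    then show "fps_nth (?G (Suc n) * (1 - fps_X ^ Suc n)) m = fps_nth (?G n) m"
      using card_inc_seqs_Suc[of n m] by (auto simp: fps_X_power_mult_nth simp del: power_Suc)
  qed
  have "qpoch (Suc n) = (1 - monom 1 (Suc n)) * qpoch n"
    by (simp add: qpoch_def mult.commute)
  then have "fps_of_poly (qpoch (Suc n)) = (1 - fps_X ^ Suc n) * fps_of_poly (qpoch n)"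
    by (simp add: fps_of_poly_mult fps_of_poly_diff fps_of_poly_monom' del: power_Suc)
  then have "?G (Suc n) * fps_of_poly (qpoch (Suc n)) =
      (?G (Suc n) * (1 - fps_X ^ Suc n)) * fps_of_poly (qpoch n)"
    by (simp only: mult.assoc)
  then show ?case unfolding G using Suc by simp
qed

text \<open>The one-variable case: the series of \<open>D\<close> is a power of \<open>q\<close>
  over \<open>(q;q)_n\<close>, stated by coefficients so that it can be applied to each variable of
  a monomial separately.\<close>

lemma inc_seqs_convolution:
  assumes D: "D \<subseteq> {1..<n}"
  shows "(\<Sum>a\<le>m. int (card (inc_seqs n D a)) * coeff (qpoch n) (m - a)) =
    of_bool (m = (\<Sum>d\<in>D. n - d))"
proof -
  let ?s = "\<Sum>d\<in>D. n - d"
  let ?G = "\<lambda>D. Abs_fps (\<lambda>m. int (card (inc_seqs n D m)))"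
  have "?G D = fps_X ^ ?s * ?G {}"
  proof (rule fps_ext)
    fix a
    show "fps_nth (?G D) a = fps_nth (fps_X ^ ?s * ?G {}) a"
      using inc_seqs_empty[OF D, of a] card_inc_seqs_shift[OF D, of "a - ?s"]
      by (cases "a < ?s") (auto simp: fps_X_power_mult_nth)
  qed
  then have "?G D * fps_of_poly (qpoch n) = fps_X ^ ?s"
    using inc_seqs_gf[of n] by (simp add: mult.assoc)
  then have "fps_nth (?G D * fps_of_poly (qpoch n)) m = of_bool (m = ?s)" by simp
  then show ?thesis by (simp add: fps_mult_nth atMost_atLeast0)
qed

section \<open>Finitely many variables\<close>

definition list_tuples :: "nat \<Rightarrow> nat \<Rightarrow> (nat \<Rightarrow> nat list) set" where
  "list_tuples n k = {S. (\<forall>j. j \<notin> {1..n} \<longrightarrow> S j = []) \<and> (\<forall>j\<in>{1..n}. length (S j) = k)}"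

text \<open>List positions start at \<open>0\<close>, so \<open>q_i\<close> marks position
  \<open>k - i\<close>; in particular \<open>q_k\<close> belongs to the most significant
  coordinate.\<close>

definition weight :: "nat \<Rightarrow> nat \<Rightarrow> (nat \<Rightarrow> nat list) \<Rightarrow> nat \<Rightarrow> nat" where
  "weight n k S i = (if i \<in> {1..k} then \<Sum>j=1..n. S j ! (k - i) else 0)"

lemma F_fin_set_eq:
  assumes R: "R \<subseteq> {1..<n}"
  shows "F_fin_set n R k e = {S\<in>list_tuples n k. sorts n (key_less R S) id \<and> weight n k S = e}"
proof -
  have "simR R j (j + 1) \<longleftrightarrow> j \<in> R" for j
  proof -
    have "{j..<j + 1} = {j}" by auto
    then show ?thesis unfolding simR_def by simp
  qed
  \<comment> \<open>Neighbours \<open>j\<close>, \<open>j + 1\<close> are equivalent iff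
    \<open>j\<close> lies in \<open>R\<close>, and then the tie-break inverts them. So the identity
    sorts \<open>S\<close> iff \<open>S\<close> increases weakly, and strictly at
    \<open>R\<close>.\<close>
  then have tie: "tie_less R j (j + 1) \<longleftrightarrow> j \<notin> R" for j
    unfolding tie_less_def by simp
  have sorts_id: "sorts n L id \<longleftrightarrow> (\<forall>i\<in>{1..<n}. L i (i + 1))" for L
    by (simp add: sorts_def)
  have "(\<forall>j\<in>{1..<n}. lexle (S j) (S (j + 1))) \<and> (\<forall>j\<in>R. lexless (S j) (S (j + 1))) \<longleftrightarrow>
      sorts n (key_less R S) id" for S
    using R unfolding sorts_id key_less_def lexle_def tie by (auto simp: lexless_irrefl)
  then show ?thesis
    unfolding F_fin_set_def list_tuples_def weight_def fun_eq_iff by auto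
qed

text \<open>The tuples for which the \<open>i\<close>-th permutation sorts the tails of length
  \<open>i\<close>, from the empty tails at \<open>i = 0\<close> to the full entries at
  \<open>i = k\<close>.\<close>

definition fibre :: "nat \<Rightarrow> nat set \<Rightarrow> nat \<Rightarrow> (nat \<Rightarrow> nat \<Rightarrow> nat) \<Rightarrow> mon \<Rightarrow> (nat \<Rightarrow> nat list) set" where
  "fibre n R k \<pi> e = {S\<in>list_tuples n k. weight n k S = e \<and>
     (\<forall>i\<le>k. sorts n (key_less R (\<lambda>j. drop (k - i) (S j))) (full_tuple R n k \<pi> i))}"

lemma length_drop_list_tuples:
  "S \<in> list_tuples n k \<Longrightarrow> i \<le> k \<Longrightarrow> a \<in> {1..n} \<Longrightarrow> length (drop (k - i) (S a)) = i"
  by (auto simp: list_tuples_def)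

lemma F_fin_set_eq_UN_fibre:
  assumes R: "R \<subseteq> {1..<n}" and k: "1 \<le> k"
  shows "F_fin_set n R k e = (\<Union>\<pi>\<in>perm_tuples n k. fibre n R k \<pi> e)"
proof (intro equalityI subsetI)
  fix S assume "S \<in> F_fin_set n R k e"
  then have S: "S \<in> list_tuples n k" "sorts n (key_less R S) id" "weight n k S = e"
    unfolding F_fin_set_eq[OF R] by auto
  let ?L = "\<lambda>i. key_less R (\<lambda>j. drop (k - i) (S j))"
  have "\<exists>\<sigma>. sorts n (?L i) \<sigma>" if "i \<le> k" for i
    by (rule sorts_exists, rule strict_linear_on_key_less)
      (rule length_drop_list_tuples[OF S(1) that])
  then obtain \<sigma> where \<sigma>: "\<And>i. i \<le> k \<Longrightarrow> sorts n (?L i) (\<sigma> i)" by metis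
  \<comment> \<open>The permutations at \<open>0\<close> and \<open>k\<close> are left out, since
    \<open>full_tuple\<close> puts them back: \<open>tauR\<close> sorts the empty tails, and
    \<open>id\<close> sorts \<open>S\<close> by assumption.\<close>
  define \<pi> where "\<pi> i = (if i \<in> {1..<k} then \<sigma> i else id)" for i
  have "\<sigma> i permutes {1..n}" if "i \<le> k" for i using \<sigma>[OF that] unfolding sorts_def by blast
  then have "\<pi> \<in> perm_tuples n k" unfolding perm_tuples_def \<pi>_def by auto
  moreover have "sorts n (?L i) (full_tuple R n k \<pi> i)" if ik: "i \<le> k" for i
  proof -
    have nil: "drop k (S j) = []" for j
      using S(1) unfolding list_tuples_def by (cases "j \<in> {1..n}") auto
    consider "i = 0" | "i = k" | "i \<in> {1..<k}" using ik by fastforce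
    then show ?thesis
    proof cases
      case 1
      then show ?thesis using sorts_tauR k by (simp add: full_tuple_def nil)
    next
      case 2
      then show ?thesis using S(2) by (simp add: full_tuple_def)
    next
      case 3
      then show ?thesis using \<sigma>[OF ik] by (auto simp: full_tuple_def \<pi>_def)
    qed
  qed
  ultimately show "S \<in> (\<Union>\<pi>\<in>perm_tuples n k. fibre n R k \<pi> e)"
    using S unfolding fibre_def by blast
next
  fix S assume "S \<in> (\<Union>\<pi>\<in>perm_tuples n k. fibre n R k \<pi> e)"
  then obtain \<pi> where S: "S \<in> list_tuples n k" "weight n k S = e"
    "sorts n (key_less R (\<lambda>j. drop (k - k) (S j))) (full_tuple R n k \<pi> k)"
    unfolding fibre_def by auto
  then show "S \<in> F_fin_set n R k e"
    unfolding F_fin_set_eq[OF R] by (simp add: full_tuple_def)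
qed

text \<open>Each tail of \<open>S\<close> has only one sorting permutation, so \<open>S\<close>
  determines the tuple.\<close>

lemma fibre_disjoint:
  assumes \<pi>: "\<pi> \<in> perm_tuples n k" and \<rho>: "\<rho> \<in> perm_tuples n k" and "\<pi> \<noteq> \<rho>"
  shows "fibre n R k \<pi> e \<inter> fibre n R k \<rho> e = {}"
proof (rule equals0I)
  fix S assume S: "S \<in> fibre n R k \<pi> e \<inter> fibre n R k \<rho> e"
  then have T: "S \<in> list_tuples n k" unfolding fibre_def by blast
  have "\<pi> i = \<rho> i" for i
  proof (cases "i \<in> {1..<k}")
    case True
    then have ik: "i \<le> k" by simp
    have "full_tuple R n k \<pi> i = full_tuple R n k \<rho> i"
      by (rule sorts_unique[OF strict_linear_on_key_less[OF length_drop_list_tuples[OF T ik]]])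
        (use S ik in \<open>auto simp: fibre_def\<close>)
    then show ?thesis using True by (simp add: full_tuple_def)
  qed (use \<pi> \<rho> in \<open>auto simp: perm_tuples_def\<close>)
  then show False using \<open>\<pi> \<noteq> \<rho>\<close> by blast
qed

definition tuple_Des :: "nat \<Rightarrow> nat set \<Rightarrow> nat \<Rightarrow> (nat \<Rightarrow> nat \<Rightarrow> nat) \<Rightarrow> nat \<Rightarrow> nat set" where
  "tuple_Des n R k \<pi> i = inv_Des n (full_tuple R n k \<pi> (i - 1)) (full_tuple R n k \<pi> i)"

text \<open>The coordinate marked by \<open>q_i\<close>, read in the order of the permutation that
  sorts the tails starting with it.\<close>

definition sorted_column :: "nat \<Rightarrow> nat set \<Rightarrow> nat \<Rightarrow> (nat \<Rightarrow> nat \<Rightarrow> nat) \<Rightarrow> (nat \<Rightarrow> nat list) \<Rightarrow>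
    nat \<Rightarrow> nat \<Rightarrow> nat" where
  "sorted_column n R k \<pi> S i a = (if a \<in> {1..n} then S (full_tuple R n k \<pi> i a) ! (k - i) else 0)"

text \<open>Climbing through the tails adds one coordinate at a time. The strict rises demanded of
  it depend on two neighbouring permutations only, not on \<open>S\<close>, so the conditions on
  different coordinates decouple.\<close>

lemma mem_fibre_iff:
  assumes \<pi>: "\<pi> \<in> perm_tuples n k" and e: "\<forall>i. i \<notin> {1..k} \<longrightarrow> e i = 0" and k: "1 \<le> k"
  shows "S \<in> fibre n R k \<pi> e \<longleftrightarrow> S \<in> list_tuples n k \<and>
    (\<forall>i\<in>{1..k}. sorted_column n R k \<pi> S i \<in> inc_seqs n (tuple_Des n R k \<pi> i) (e i))"
proof (cases "S \<in> list_tuples n k")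
  case S: True
  let ?P = "full_tuple R n k \<pi>"
  let ?T = "\<lambda>i j. drop (k - i) (S j)"
  let ?inc = "\<lambda>i. \<forall>a\<in>{1..<n}. S (?P i a) ! (k - i) \<le> S (?P i (a + 1)) ! (k - i) \<and>
    (a \<in> tuple_Des n R k \<pi> i \<longrightarrow> S (?P i a) ! (k - i) < S (?P i (a + 1)) ! (k - i))"
  note P = full_tuple_permutes[OF \<pi>]
  have step: "sorts n (key_less R (?T i)) (?P i) \<longleftrightarrow> ?inc i"
    if "i \<in> {1..k}" "sorts n (key_less R (?T (i - 1))) (?P (i - 1))" for i
  proof -
    have i: "i - 1 \<le> k" "i \<le> k" using that(1) by auto
    have T: "?T i a = S a ! (k - i) # ?T (i - 1) a" if a: "a \<in> {1..n}" for a
    proof -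
      have "k - i < length (S a)" "Suc (k - i) = k - (i - 1)"
        using S a \<open>i \<in> {1..k}\<close> by (auto simp: list_tuples_def)
      then show ?thesis by (metis Cons_nth_drop_Suc)
    qed
    show ?thesis
      using sorts_key_less_Cons_iff[OF length_drop_list_tuples[OF S i(1)] that(2) P[OF i(2)] T]
      unfolding tuple_Des_def by simp
  qed
  \<comment> \<open>Here \<open>1 \<le> k\<close> ensures that \<open>full_tuple\<close> has
    \<open>tauR\<close> at \<open>0\<close>.\<close>
  have zero: "sorts n (key_less R (?T 0)) (?P 0)"
  proof -
    have "?T 0 j = []" for j using S unfolding list_tuples_def by (cases "j \<in> {1..n}") auto
    then have "?T 0 = (\<lambda>_. [])" by blast
    then show ?thesis using sorts_tauR k by (simp only: full_tuple_def) simp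
  qed
  have "(\<forall>i\<le>k. sorts n (key_less R (?T i)) (?P i)) \<longleftrightarrow> (\<forall>i\<in>{1..k}. ?inc i)"
  proof (rule iffI, rule ballI)
    fix i assume h: "\<forall>i\<le>k. sorts n (key_less R (?T i)) (?P i)" and i: "i \<in> {1..k}"
    then have "i - 1 \<le> k" "i \<le> k" by auto
    then show "?inc i" using step[OF i] h by blast
  next
    assume inc: "\<forall>i\<in>{1..k}. ?inc i"
    have "sorts n (key_less R (?T i)) (?P i)" if "i \<le> k" for i
      using that
    proof (induction i)
      case (Suc i)
      then have "sorts n (key_less R (?T (Suc i - 1))) (?P (Suc i - 1))" by simp
      moreover have "Suc i \<in> {1..k}" using Suc.prems by simp
      ultimately show ?case using step inc by blast
    qed (rule zero)
    then show "\<forall>i\<le>k. sorts n (key_less R (?T i)) (?P i)" by blast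
  qed
  moreover have "weight n k S = e \<longleftrightarrow> (\<forall>i\<in>{1..k}. (\<Sum>j=1..n. S (?P i j) ! (k - i)) = e i)"
  proof -
    have "(\<Sum>j=1..n. S (?P i j) ! (k - i)) = (\<Sum>j=1..n. S j ! (k - i))" if "i \<in> {1..k}" for i
      using sum.permute[OF P[of i], of "\<lambda>j. S j ! (k - i)"] that by (simp add: o_def)
    then show ?thesis using e unfolding weight_def fun_eq_iff by auto
  qed
  moreover have "sorted_column n R k \<pi> S i \<in> inc_seqs n (tuple_Des n R k \<pi> i) (e i) \<longleftrightarrow>
      ?inc i \<and> (\<Sum>j=1..n. S (?P i j) ! (k - i)) = e i" for i
  proof -
    have "(\<Sum>j=1..n. sorted_column n R k \<pi> S i j) = (\<Sum>j=1..n. S (?P i j) ! (k - i))"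
      by (rule sum.cong) (auto simp: sorted_column_def)
    then show ?thesis unfolding inc_seqs_def by (auto simp: sorted_column_def)
  qed
  ultimately show ?thesis using S unfolding fibre_def by auto
qed (simp add: fibre_def)

lemma bij_betw_fibre:
  assumes \<pi>: "\<pi> \<in> perm_tuples n k" and e: "\<forall>i. i \<notin> {1..k} \<longrightarrow> e i = 0" and k: "1 \<le> k"
  shows "bij_betw (\<lambda>S. restrict (sorted_column n R k \<pi> S) {1..k}) (fibre n R k \<pi> e)
    (\<Pi>\<^sub>E i\<in>{1..k}. inc_seqs n (tuple_Des n R k \<pi> i) (e i))"
proof -
  let ?P = "full_tuple R n k \<pi>"
  let ?Y = "\<lambda>i. inc_seqs n (tuple_Des n R k \<pi> i) (e i)"
  \<comment> \<open>The inverse puts the entries of each column back in place by undoing its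
    permutation; list position \<open>m\<close> belongs to the variable
    \<open>k - m\<close>.\<close>
  let ?g = "\<lambda>y j. if j \<in> {1..n} then map (\<lambda>m. y (k - m) (inv (?P (k - m)) j)) [0..<k] else []"
  note P = full_tuple_permutes[OF \<pi>]
  have mem: "?P i a \<in> {1..n}" if "i \<in> {1..k}" "a \<in> {1..n}" for i a
    using permutes_in_image[OF P, of i R a] that by auto
  have col: "sorted_column n R k \<pi> (?g y) i = y i" if "i \<in> {1..k}" "y i \<in> ?Y i" for y i
  proof
    fix a
    show "sorted_column n R k \<pi> (?g y) i a = y i a"
    proof (cases "a \<in> {1..n}")
      case True
      then show ?thesis using mem[OF that(1) True] that(1) permutes_inverses[OF P, of i R]
        by (auto simp: sorted_column_def)
    next
      case False
      then show ?thesis using that(2) unfolding inc_seqs_def sorted_column_def by auto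
    qed
  qed
  show ?thesis
  proof (rule bij_betw_byWitness[where f' = ?g])
    show "\<forall>S\<in>fibre n R k \<pi> e. ?g (restrict (sorted_column n R k \<pi> S) {1..k}) = S"
    proof (intro ballI ext)
      fix S j assume "S \<in> fibre n R k \<pi> e"
      then have S: "S \<in> list_tuples n k" unfolding fibre_def by blast
      show "?g (restrict (sorted_column n R k \<pi> S) {1..k}) j = S j"
      proof (cases "j \<in> {1..n}")
        case j: True
        have "length (S j) = k" using S j unfolding list_tuples_def by blast
        moreover have "sorted_column n R k \<pi> S (k - m) (inv (?P (k - m)) j) = S j ! m"
          if "m < k" for m
        proof -
          have "inv (?P (k - m)) j \<in> {1..n}"
            using permutes_in_image[OF permutes_inv[OF P[of "k - m" R]]] j by auto
          then show ?thesis
            using that permutes_inverses(1)[OF P[of "k - m" R]] by (simp add: sorted_column_def)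
        qed
        moreover have "k - m \<in> {1..k}" if "m < k" for m using that by auto
        ultimately show ?thesis using j by (intro nth_equalityI) simp_all
      qed (use S in \<open>auto simp: list_tuples_def\<close>)
    qed
    show "\<forall>y\<in>Pi\<^sub>E {1..k} ?Y. restrict (sorted_column n R k \<pi> (?g y)) {1..k} = y"
    proof
      fix y assume y: "y \<in> Pi\<^sub>E {1..k} ?Y"
      show "restrict (sorted_column n R k \<pi> (?g y)) {1..k} = y"
      proof (rule extensionalityI)
        fix i assume i: "i \<in> {1..k}"
        then show "restrict (sorted_column n R k \<pi> (?g y)) {1..k} i = y i"
          using col[of i y, OF i PiE_mem[OF y i]] by simp
      qed (use y in \<open>auto simp: PiE_def\<close>)
    qed
    show "(\<lambda>S. restrict (sorted_column n R k \<pi> S) {1..k}) ` fibre n R k \<pi> e \<subseteq> Pi\<^sub>E {1..k} ?Y"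
      using mem_fibre_iff[OF \<pi> e k] by auto
    show "?g ` Pi\<^sub>E {1..k} ?Y \<subseteq> fibre n R k \<pi> e"
    proof safe
      fix y assume y: "y \<in> Pi\<^sub>E {1..k} ?Y"
      have "?g y \<in> list_tuples n k" unfolding list_tuples_def by auto
      moreover have "sorted_column n R k \<pi> (?g y) i \<in> ?Y i" if i: "i \<in> {1..k}" for i
        using col[of i y, OF i PiE_mem[OF y i]] PiE_mem[OF y i] by simp
      ultimately show "?g y \<in> fibre n R k \<pi> e"
        using mem_fibre_iff[OF \<pi> e k] by blast
    qed
  qed
qed

section \<open>Finiteness and the coefficients of \<open>F_fin\<close>\<close>

lemma finite_perm_tuples: "finite (perm_tuples n k)"
proof -
  have "perm_tuples n k \<subseteq> {\<pi>. \<forall>i. (i \<in> {1..<k} \<longrightarrow> \<pi> i \<in> {p. p permutes {1..n}}) \<and>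
      (i \<notin> {1..<k} \<longrightarrow> \<pi> i = id)}"
    by (auto simp: perm_tuples_def)
  then show ?thesis
    by (rule finite_subset) (intro finite_set_of_finite_funs; simp add: finite_permutations)
qed

lemma finite_num_fin_set: "finite (num_fin_set n R k e)"
  using finite_perm_tuples unfolding num_fin_set_def by simp

lemma F_fin_set_empty:
  assumes "i \<notin> {1..k}" "e i \<noteq> 0"
  shows "F_fin_set n R k e = {}"
  using assms unfolding F_fin_set_def by fastforce

lemma finite_fibre:
  assumes "\<pi> \<in> perm_tuples n k" "\<forall>i. i \<notin> {1..k} \<longrightarrow> e i = 0" "1 \<le> k"
  shows "finite (fibre n R k \<pi> e)"
  using bij_betw_finite[OF bij_betw_fibre[OF assms]] finite_inc_seqs
  by (simp add: finite_PiE)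

lemma finite_F_fin_set:
  assumes "R \<subseteq> {1..<n}" "1 \<le> k"
  shows "finite (F_fin_set n R k e)"
proof (cases "\<forall>i. i \<notin> {1..k} \<longrightarrow> e i = 0")
  case True
  then show ?thesis
    unfolding F_fin_set_eq_UN_fibre[OF assms]
    using finite_perm_tuples finite_fibre[OF _ True assms(2)] by blast
next
  case False
  then obtain i where "i \<notin> {1..k}" "e i \<noteq> 0" by blast
  then show ?thesis by (simp add: F_fin_set_empty)
qed

lemma F_fin_eq:
  assumes R: "R \<subseteq> {1..<n}" and k: "1 \<le> k" and e: "\<forall>i. i \<notin> {1..k} \<longrightarrow> e i = 0"
  shows "F_fin n R k e =
    (\<Sum>\<pi>\<in>perm_tuples n k. \<Prod>i\<in>{1..k}. int (card (inc_seqs n (tuple_Des n R k \<pi> i) (e i))))"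
proof -
  have "card (F_fin_set n R k e) = (\<Sum>\<pi>\<in>perm_tuples n k. card (fibre n R k \<pi> e))"
    unfolding F_fin_set_eq_UN_fibre[OF R k]
    by (intro card_UN_disjoint finite_perm_tuples ballI impI)
      (use finite_fibre e k fibre_disjoint in blast)+
  also have "\<dots> = (\<Sum>\<pi>\<in>perm_tuples n k.
      \<Prod>i\<in>{1..k}. card (inc_seqs n (tuple_Des n R k \<pi> i) (e i)))"
    using bij_betw_same_card[OF bij_betw_fibre[OF _ e k]] by (intro sum.cong) (simp_all add: card_PiE)
  finally show ?thesis unfolding F_fin_def by simp
qed

lemma coeff_qpoch_0: "coeff (qpoch n) 0 = 1"
proof -
  have "poly (qpoch n) 0 = 1"
    unfolding qpoch_def poly_prod by (rule prod.neutral) (auto simp: poly_monom)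
  then show ?thesis by (simp add: poly_0_coeff_0)
qed

text \<open>Variables of exponent \<open>0\<close> contribute the constant term \<open>1\<close> of
  \<open>qpoch\<close>, so the product over the support extends to \<open>{1..k}\<close>, and an
  infinite \<open>V\<close> gives the same value.\<close>

lemma qpoch_prod_eq:
  assumes e: "\<forall>i. i \<notin> {1..k} \<longrightarrow> e i = 0" and V: "{1..k} \<subseteq> V"
  shows "qpoch_prod n V e = (\<Prod>i\<in>{1..k}. coeff (qpoch n) (e i))"
proof -
  have sub: "{i. e i \<noteq> 0} \<subseteq> {1..k}" by (rule subsetI) (metis e mem_Collect_eq)
  then have "finsupp_mon e" unfolding finsupp_mon_def by (rule finite_subset) simp
  moreover have "\<forall>i. i \<notin> V \<longrightarrow> e i = 0" using sub V by blast
  moreover have "(\<Prod>i\<in>{i. e i \<noteq> 0}. coeff (qpoch n) (e i)) = (\<Prod>i\<in>{1..k}. coeff (qpoch n) (e i))"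
    by (rule prod.mono_neutral_left) (use sub in \<open>auto simp: coeff_qpoch_0\<close>)
  ultimately show ?thesis unfolding qpoch_prod_def by simp
qed

lemma bij_betw_divisors_PiE:
  fixes e :: mon
  assumes e: "\<forall>i. i \<notin> {1..k} \<longrightarrow> e i = 0"
  shows "bij_betw (\<lambda>d. restrict d {1..k}) {d. \<forall>i. d i \<le> e i} (\<Pi>\<^sub>E i\<in>{1..k}. {..e i})"
proof (rule bij_betw_byWitness[where f' = "\<lambda>d i. if i \<in> {1..k} then d i else 0"])
  show "\<forall>d\<in>{d. \<forall>i. d i \<le> e i}. (\<lambda>i. if i \<in> {1..k} then restrict d {1..k} i else 0) = d"
  proof (intro ballI ext)
    fix d i assume "d \<in> {d. \<forall>i. d i \<le> e i}"
    then have "d i \<le> e i" by blast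
    then show "(if i \<in> {1..k} then restrict d {1..k} i else 0) = d i" using e by auto
  qed
qed (auto simp: fun_eq_iff PiE_def extensional_def)

text \<open>If a monomial contains a variable outside \<open>V\<close>, so does one factor of every
  splitting of it.\<close>

lemma mps_mult_eq_0:
  assumes "\<And>d. \<exists>i. i \<notin> V \<and> d i \<noteq> 0 \<Longrightarrow> f d = 0" "\<And>d. \<exists>i. i \<notin> V \<and> d i \<noteq> 0 \<Longrightarrow> g d = 0"
    and "i \<notin> V" "e i \<noteq> 0"
  shows "mps_mult f g e = 0"
  unfolding mps_mult_def
proof (rule sum.neutral, rule ballI)
  fix d assume "d \<in> {d. \<forall>i. d i \<le> e i}"
  then have "d i \<noteq> 0 \<or> e i - d i \<noteq> 0" using assms(4) by auto
  then show "f d * g (\<lambda>i. e i - d i) = 0" using assms(1)[of d] assms(2)[of "\<lambda>i. e i - d i"] assms(3)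
    by (metis mult_eq_0_iff)
qed

lemma F_fin_mult_qpoch_prod:
  assumes R: "R \<subseteq> {1..<n}" and k: "1 \<le> k"
  shows "mps_mult (F_fin n R k) (qpoch_prod n {1..k}) e = num_fin n R k e"
proof (cases "\<forall>i. i \<notin> {1..k} \<longrightarrow> e i = 0")
  case e: True
  let ?c = "\<lambda>\<pi> i a. int (card (inc_seqs n (tuple_Des n R k \<pi> i) a))"
  let ?q = "\<lambda>i a. coeff (qpoch n) (e i - a)"
  have "mps_mult (F_fin n R k) (qpoch_prod n {1..k}) e =
      (\<Sum>d | \<forall>i. d i \<le> e i. \<Sum>\<pi>\<in>perm_tuples n k. \<Prod>i\<in>{1..k}. ?c \<pi> i (d i) * ?q i (d i))"
    unfolding mps_mult_def
  proof (rule sum.cong)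
    fix d assume "d \<in> {d. \<forall>i. d i \<le> e i}"
    then have d: "\<forall>i. i \<notin> {1..k} \<longrightarrow> d i = 0" using e by (metis le_zero_eq mem_Collect_eq)
    have "qpoch_prod n {1..k} (\<lambda>i. e i - d i) = (\<Prod>i\<in>{1..k}. ?q i (d i))"
      by (rule qpoch_prod_eq) (use e in auto)
    then show "F_fin n R k d * qpoch_prod n {1..k} (\<lambda>i. e i - d i) =
        (\<Sum>\<pi>\<in>perm_tuples n k. \<Prod>i\<in>{1..k}. ?c \<pi> i (d i) * ?q i (d i))"
      using F_fin_eq[OF R k d] by (simp add: prod.distrib sum_distrib_right)
  qed simp
  also have "\<dots> = (\<Sum>\<pi>\<in>perm_tuples n k. \<Sum>d | \<forall>i. d i \<le> e i. \<Prod>i\<in>{1..k}. ?c \<pi> i (d i) * ?q i (d i))"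
    by (rule sum.swap)
  also have "\<dots> = (\<Sum>\<pi>\<in>perm_tuples n k. of_bool (\<forall>i\<in>{1..k}. e i = comaj R n k \<pi> i))"
  proof (rule sum.cong)
    fix \<pi> assume \<pi>: "\<pi> \<in> perm_tuples n k"
    have D: "tuple_Des n R k \<pi> i \<subseteq> {1..<n}" for i by (auto simp: tuple_Des_def inv_Des_def)
    have "(\<Sum>d | \<forall>i. d i \<le> e i. \<Prod>i\<in>{1..k}. ?c \<pi> i (d i) * ?q i (d i)) =
        (\<Sum>d\<in>(\<Pi>\<^sub>E i\<in>{1..k}. {..e i}). \<Prod>i\<in>{1..k}. ?c \<pi> i (d i) * ?q i (d i))"
      by (subst sum.reindex_bij_betw[OF bij_betw_divisors_PiE[OF e], symmetric])
        (auto intro!: sum.cong prod.cong)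
    \<comment> \<open>A sum over a box of products with one factor per variable is a product of
      one-variable sums, each an instance of \<open>inc_seqs_convolution\<close>.\<close>
    also have "\<dots> = (\<Prod>i\<in>{1..k}. \<Sum>a\<le>e i. ?c \<pi> i a * ?q i a)"
      by (rule prod_sum_PiE[symmetric]) auto
    also have "\<dots> = (\<Prod>i\<in>{1..k}. of_bool (e i = (\<Sum>d\<in>tuple_Des n R k \<pi> i. n - d)))"
      unfolding inc_seqs_convolution[OF D] ..
    also have "\<dots> = (\<Prod>i\<in>{1..k}. of_bool (e i = comaj R n k \<pi> i))"
    proof (rule prod.cong)
      fix i assume i: "i \<in> {1..k}"
      have "comaj R n k \<pi> i = (\<Sum>d\<in>tuple_Des n R k \<pi> i. n - d)"
        unfolding tuple_Des_def inv_comaj_def[symmetric]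
        by (rule comaj_eq_inv_comaj[OF _ i]) (use \<pi> in \<open>auto simp: perm_tuples_def\<close>)
      then show "of_bool (e i = (\<Sum>d\<in>tuple_Des n R k \<pi> i. n - d)) =
          (of_bool (e i = comaj R n k \<pi> i) :: int)" by simp
    qed simp
    also have "\<dots> = of_bool (\<forall>i\<in>{1..k}. e i = comaj R n k \<pi> i)"
      by (cases "\<forall>i\<in>{1..k}. e i = comaj R n k \<pi> i") auto
    finally show "(\<Sum>d | \<forall>i. d i \<le> e i. \<Prod>i\<in>{1..k}. ?c \<pi> i (d i) * ?q i (d i)) =
      of_bool (\<forall>i\<in>{1..k}. e i = comaj R n k \<pi> i)" .
  qed simp
  also have "\<dots> = num_fin n R k e"
  proof -
    have "num_fin_set n R k e = perm_tuples n k \<inter> {\<pi>. \<forall>i\<in>{1..k}. e i = comaj R n k \<pi> i}"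
      using e unfolding num_fin_set_def by auto
    then show ?thesis using finite_perm_tuples by (simp add: num_fin_def)
  qed
  finally show ?thesis .
next
  case False
  \<comment> \<open>Both sides vanish at a monomial with an index outside \<open>{1..k}\<close>,
    including the index \<open>0\<close>.\<close>
  then obtain i where i: "i \<notin> {1..k}" "e i \<noteq> 0" by blast
  have "num_fin_set n R k e = {}" using i unfolding num_fin_set_def by force
  moreover have "mps_mult (F_fin n R k) (qpoch_prod n {1..k}) e = 0"
  proof (rule mps_mult_eq_0[where V = "{1..k}" and i = i and e = e, OF _ _ i])
    show "F_fin n R k d = 0" if "\<exists>i. i \<notin> {1..k} \<and> d i \<noteq> 0" for d
      using that F_fin_set_empty unfolding F_fin_def by (metis card.empty of_nat_0)
  qed (auto simp: qpoch_prod_def)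
  ultimately show ?thesis by (simp add: num_fin_def)
qed

section \<open>Infinitely many variables\<close>

text \<open>In \<open>F_fin\<close> the most significant coordinate is marked by \<open>q_k\<close>,
  in \<open>F_inf\<close> by \<open>q_1\<close>; this reversal reconciles the two.\<close>

definition rev_mon :: "nat \<Rightarrow> mon \<Rightarrow> mon" where
  "rev_mon k e i = (if i \<in> {1..k} then e (k + 1 - i) else 0)"

lemma rev_mon_outside: "i \<notin> {1..k} \<Longrightarrow> rev_mon k e i = 0"
  unfolding rev_mon_def by (rule if_not_P)

lemma rev_mon_rev_mon:
  assumes "\<forall>i. i \<notin> {1..k} \<longrightarrow> e i = 0"
  shows "rev_mon k (rev_mon k e) = e"
proof
  fix i
  show "rev_mon k (rev_mon k e) i = e i"
    using assms unfolding rev_mon_def by auto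
qed

lemma ball_rev: "(\<forall>i\<in>{1..k::nat}. P (k + 1 - i)) \<longleftrightarrow> (\<forall>i\<in>{1..k}. P i)"
proof (intro iffI ballI)
  fix i assume *: "\<forall>i\<in>{1..k}. P (k + 1 - i)" and "i \<in> {1..k}"
  then have "k + 1 - i \<in> {1..k}" "k + 1 - (k + 1 - i) = i" by auto
  then show "P i" using * by metis
next
  fix i assume *: "\<forall>i\<in>{1..k}. P i" and "i \<in> {1..k}"
  then have "k + 1 - i \<in> {1..k}" by auto
  then show "P (k + 1 - i)" using * by blast
qed

section \<open>Truncating sequences to lists\<close>

lemma lexless_iff_nth:
  "length xs = length ys \<Longrightarrow>
    lexless xs ys \<longleftrightarrow> (\<exists>i<length xs. xs ! i < ys ! i \<and> (\<forall>l<i. xs ! l = ys ! l))"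
  by (induction xs ys rule: list_induct2) (auto simp: Ex_less_Suc2 All_less_Suc2)

lemma seqless_iff_lexless:
  assumes z: "\<forall>i. i \<notin> {1..k} \<longrightarrow> z i = 0" and w: "\<forall>i. i \<notin> {1..k} \<longrightarrow> w i = 0"
  shows "seqless z w \<longleftrightarrow> lexless (map z [1..<k + 1]) (map w [1..<k + 1])"
proof -
  have seq: "seqless z w \<longleftrightarrow> (\<exists>i<k. z (i + 1) < w (i + 1) \<and> (\<forall>l<i. z (l + 1) = w (l + 1)))"
  proof
    assume "seqless z w"
    then obtain i where i: "z i < w i" "\<forall>l<i. z l = w l" unfolding seqless_def by blast
    \<comment> \<open>At the first difference \<open>w\<close> is positive, so that index lies in
      its support.\<close>
    then have "i \<in> {1..k}" using w by (metis not_less_zero)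
    then have "i - 1 < k \<and> z (i - 1 + 1) < w (i - 1 + 1) \<and> (\<forall>l<i - 1. z (l + 1) = w (l + 1))"
      using i by auto
    then show "\<exists>i<k. z (i + 1) < w (i + 1) \<and> (\<forall>l<i. z (l + 1) = w (l + 1))" by blast
  next
    assume "\<exists>i<k. z (i + 1) < w (i + 1) \<and> (\<forall>l<i. z (l + 1) = w (l + 1))"
    then obtain i where i: "z (i + 1) < w (i + 1)" "\<forall>l<i. z (l + 1) = w (l + 1)" by blast
    have "z l = w l" if "l < i + 1" for l
    proof (cases l)
      case (Suc l')
      then show ?thesis using i(2) that by simp
    qed (use z w in simp)
    then show "seqless z w" using i(1) unfolding seqless_def by blast
  qed
  have nth: "map v [1..<k + 1] ! i = v (i + 1)" if "i < k" for v :: "nat \<Rightarrow> nat" and i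
    using that by (simp del: upt_Suc)
  have "lexless (map z [1..<k + 1]) (map w [1..<k + 1]) \<longleftrightarrow>
      (\<exists>i<k. map z [1..<k + 1] ! i < map w [1..<k + 1] ! i \<and>
        (\<forall>l<i. map z [1..<k + 1] ! l = map w [1..<k + 1] ! l))"
    by (subst lexless_iff_nth) (simp_all del: upt_Suc)
  also have "\<dots> \<longleftrightarrow> (\<exists>i<k. z (i + 1) < w (i + 1) \<and> (\<forall>l<i. z (l + 1) = w (l + 1)))"
    by (intro ex_cong1 conj_cong all_cong1 imp_cong refl) (simp_all only: nth less_trans)
  finally show ?thesis unfolding seq by (rule sym)
qed

lemma seqle_iff_lexle:
  assumes z: "\<forall>i. i \<notin> {1..k} \<longrightarrow> z i = 0" and w: "\<forall>i. i \<notin> {1..k} \<longrightarrow> w i = 0"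
  shows "seqle z w \<longleftrightarrow> lexle (map z [1..<k + 1]) (map w [1..<k + 1])"
proof -
  have "z i = w i" if "map z [1..<k + 1] = map w [1..<k + 1]" for i
  proof (cases "i \<in> {1..k}")
    case True
    then have "i \<in> set [1..<k + 1]" by auto
    then show ?thesis using that by (metis map_eq_conv)
  qed (simp add: z w)
  then have "z = w \<longleftrightarrow> map z [1..<k + 1] = map w [1..<k + 1]" by blast
  then show ?thesis
    unfolding seqle_def lexle_def using seqless_iff_lexless[of k z w] z w by blast
qed

text \<open>A vanishing exponent forces every natural number in its sum to vanish, so the sequences
  live on \<open>{1..k}\<close> and are the same as lists of length \<open>k\<close>.\<close>

lemma bij_betw_F_inf_set:
  assumes R: "R \<subseteq> {1..<n}" and e: "\<forall>i. i \<notin> {1..k} \<longrightarrow> e i = 0"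
  shows "bij_betw (\<lambda>Z j. if j \<in> {1..n} then map (Z j) [1..<k + 1] else [])
    (F_inf_set n R e) (F_fin_set n R k (rev_mon k e))"
proof -
  let ?enc = "\<lambda>Z j. if j \<in> {1..n} then map (Z j) [1..<k + 1] else []"
  define A :: "(nat \<Rightarrow> nat \<Rightarrow> nat) set" where
    "A = {Z. \<forall>j i. i \<notin> {1..k} \<or> j \<notin> {1..n} \<longrightarrow> Z j i = 0}"
  define P where "P Z \<longleftrightarrow> (\<forall>j\<in>{1..<n}. seqle (Z j) (Z (j + 1))) \<and>
    (\<forall>j\<in>R. seqless (Z j) (Z (j + 1))) \<and> (\<forall>i\<in>{1..k}. e i = (\<Sum>j=1..n. Z j i))" for Z
  define Q where "Q S \<longleftrightarrow> (\<forall>j\<in>{1..<n}. lexle (S j) (S (j + 1))) \<and>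
    (\<forall>j\<in>R. lexless (S j) (S (j + 1))) \<and>
    (\<forall>i\<in>{1..k}. rev_mon k e i = (\<Sum>j=1..n. S j ! (k - i)))" for S
  have bij: "bij_betw ?enc A (list_tuples n k)"
  proof (rule bij_betw_byWitness[where
        f' = "\<lambda>S j i. if i \<in> {1..k} \<and> j \<in> {1..n} then S j ! (i - 1) else 0"])
    show "\<forall>Z\<in>A. (\<lambda>j i. if i \<in> {1..k} \<and> j \<in> {1..n} then ?enc Z j ! (i - 1) else 0) = Z"
      unfolding A_def by (auto simp: fun_eq_iff simp del: upt_Suc)
    show "\<forall>S\<in>list_tuples n k.
        ?enc (\<lambda>j i. if i \<in> {1..k} \<and> j \<in> {1..n} then S j ! (i - 1) else 0) = S"
      unfolding list_tuples_def
      by (auto simp: fun_eq_iff simp del: upt_Suc intro!: nth_equalityI)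
  qed (auto simp: A_def list_tuples_def simp del: upt_Suc)
  have PQ: "Q (?enc Z) \<longleftrightarrow> P Z" if Z: "Z \<in> A" for Z
  proof -
    have z: "Z j i = 0" if "i \<notin> {1..k}" for i j using Z that unfolding A_def by blast
    have "lexle (?enc Z j) (?enc Z (j + 1)) \<longleftrightarrow> seqle (Z j) (Z (j + 1))"
      "lexless (?enc Z j) (?enc Z (j + 1)) \<longleftrightarrow> seqless (Z j) (Z (j + 1))" if "j \<in> {1..<n}" for j
      using that seqle_iff_lexle[of k "Z j" "Z (j + 1)"] seqless_iff_lexless[of k "Z j" "Z (j + 1)"] z
      by (simp_all del: upt_Suc)
    moreover have "(\<forall>i\<in>{1..k}. rev_mon k e i = (\<Sum>j=1..n. ?enc Z j ! (k - i))) \<longleftrightarrow>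
        (\<forall>i\<in>{1..k}. e i = (\<Sum>j=1..n. Z j i))" (is "?l \<longleftrightarrow> ?r")
    proof -
      \<comment> \<open>The lists start at index \<open>1\<close>, so list position
        \<open>k - i\<close> holds the term of index \<open>k + 1 - i\<close>.\<close>
      have sum: "(\<Sum>j=1..n. ?enc Z j ! (k - i)) = (\<Sum>j=1..n. Z j (k + 1 - i))" if "i \<in> {1..k}" for i
        by (rule sum.cong) (use that in \<open>auto simp: Suc_diff_le simp del: upt_Suc\<close>)
      have "?l \<longleftrightarrow> (\<forall>i\<in>{1..k}. e (k + 1 - i) = (\<Sum>j=1..n. Z j (k + 1 - i)))"
        by (rule ball_cong[OF refl]) (subst sum, assumption, simp add: rev_mon_def)
      also have "\<dots> \<longleftrightarrow> ?r" by (rule ball_rev)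
      finally show ?thesis .
    qed
    ultimately show ?thesis unfolding P_def Q_def using R by (meson subsetD)
  qed
  have "F_inf_set n R e = {Z\<in>A. P Z}"
  proof (intro equalityI subsetI)
    fix Z assume Z: "Z \<in> F_inf_set n R e"
    have "Z j i = 0" if "i \<notin> {1..k} \<or> j \<notin> {1..n}" for i j
    proof (cases "j \<in> {1..n}")
      case True
      then have "(\<Sum>j=1..n. Z j i) = 0" using Z e that unfolding F_inf_set_def by auto
      then show ?thesis using True by simp
    next
      case False
      then have "Z j = (\<lambda>_. 0)" using Z unfolding F_inf_set_def by blast
      then show ?thesis by simp
    qed
    then show "Z \<in> {Z\<in>A. P Z}" using Z unfolding F_inf_set_def A_def P_def by blast
  next
    fix Z assume Z: "Z \<in> {Z\<in>A. P Z}"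
    have z: "Z j i = 0" if "i \<notin> {1..k} \<or> j \<notin> {1..n}" for i j using Z that unfolding A_def by blast
    have "finite {i. Z j i \<noteq> 0}" for j
      by (rule finite_subset[of _ "{1..k}"]) (metis (mono_tags, lifting) mem_Collect_eq subsetI z, simp)
    moreover have "e i = (\<Sum>j=1..n. Z j i)" for i
      using Z e z[of i] unfolding P_def by (cases "i \<in> {1..k}") auto
    moreover have "Z j = (\<lambda>_. 0)" if "j \<notin> {1..n}" for j using z that by blast
    moreover have "Z j 0 = 0" for j using z by simp
    ultimately show "Z \<in> F_inf_set n R e" using Z unfolding F_inf_set_def P_def by blast
  qed
  moreover have "F_fin_set n R k (rev_mon k e) = {S\<in>list_tuples n k. Q S}"
    unfolding F_fin_set_def list_tuples_def Q_def using rev_mon_outside[of _ k e] by auto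
  ultimately show ?thesis using bij_betw_Collect[OF bij, of Q P] PQ by simp
qed

text \<open>Without descents, \<open>\<sigma>\<close> sorts the order in which
  \<open>inv \<rho>\<close> ranks the elements; \<open>\<rho>\<close> sorts it too, and the sorting
  permutation is unique.\<close>

lemma inv_comaj_eq_0_iff:
  assumes \<rho>: "\<rho> permutes {1..n}" and \<sigma>: "\<sigma> permutes {1..n}"
  shows "inv_comaj n \<rho> \<sigma> = 0 \<longleftrightarrow> \<sigma> = \<rho>"
proof
  let ?L = "\<lambda>a b. inv \<rho> a < inv \<rho> b"
  have inj: "inv \<rho> a = inv \<rho> b \<longleftrightarrow> a = b" for a b
    by (rule inj_eq[OF permutes_inj[OF permutes_inv[OF \<rho>]]])
  have "totalp_on {1..n} ?L" by (rule totalp_onI) (metis inj linorder_neqE_nat)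
  then have L: "strict_linear_on {1..n} ?L"
    unfolding strict_linear_on_def by (auto intro: irreflp_onI transp_onI)
  assume "inv_comaj n \<rho> \<sigma> = 0"
  then have "inv_Des n \<rho> \<sigma> = {}" unfolding inv_comaj_def inv_Des_def by auto
  moreover have "\<sigma> (i + 1) \<noteq> \<sigma> i" for i by (simp add: inj_eq[OF permutes_inj[OF \<sigma>]])
  ultimately have "inv \<rho> (\<sigma> i) < inv \<rho> (\<sigma> (i + 1))" if "i \<in> {1..<n}" for i
    using that inj unfolding inv_Des_def by (metis (no_types, lifting) empty_Collect_eq linorder_neqE_nat)
  then have "sorts n ?L \<sigma>" using \<sigma> unfolding sorts_def by blast
  moreover have "sorts n ?L \<rho>"
    using \<rho> by (simp add: sorts_def permutes_inverses[OF \<rho>])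
  ultimately show "\<sigma> = \<rho>" by (rule sorts_unique[OF L])
next
  assume "\<sigma> = \<rho>"
  then show "inv_comaj n \<rho> \<sigma> = 0"
    by (simp add: inv_comaj_def inv_Des_def permutes_inverses[OF \<rho>])
qed

section \<open>Eventually constant sequences of permutations read backwards\<close>

definition rev_tuple :: "nat \<Rightarrow> (nat \<Rightarrow> nat \<Rightarrow> nat) \<Rightarrow> nat \<Rightarrow> nat \<Rightarrow> nat" where
  "rev_tuple m \<sigma> i = (if i \<in> {1..<m} then \<sigma> (m + 1 - i) else id)"

text \<open>The ends supplied by \<open>full_tuple\<close> match the sequence: position
  \<open>0\<close> is the permutation of index \<open>m + 1\<close>, which is \<open>tauR\<close>,
  and position \<open>m\<close> is the one of index \<open>1\<close>, which is
  \<open>id\<close>.\<close>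

lemma comaj_rev_tuple:
  assumes \<sigma>: "\<And>i. \<sigma> i permutes {1..n}" "\<sigma> 1 = id" "\<And>i. m < i \<Longrightarrow> \<sigma> i = tauR R n"
    and j: "j \<in> {1..m}"
  shows "comaj R n m (rev_tuple m \<sigma>) (m - j + 1) = inv_comaj n (\<sigma> (j + 1)) (\<sigma> j)"
proof -
  have full: "full_tuple R n m (rev_tuple m \<sigma>) i = \<sigma> (m + 1 - i)" if "i \<le> m" for i
    using that j \<sigma>(2) \<sigma>(3)[of "m + 1"] by (auto simp: full_tuple_def rev_tuple_def)
  have "comaj R n m (rev_tuple m \<sigma>) (m - j + 1) =
      inv_comaj n (full_tuple R n m (rev_tuple m \<sigma>) (m - j + 1 - 1))
        (full_tuple R n m (rev_tuple m \<sigma>) (m - j + 1))"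
    by (rule comaj_eq_inv_comaj) (use \<sigma>(1) j in \<open>auto simp: rev_tuple_def\<close>)
  moreover have "m - j + 1 \<le> m" "m + 1 - (m - j + 1) = j" "m + 1 - (m - j) = j + 1"
    using j by auto
  ultimately show ?thesis using full[of "m - j + 1"] full[of "m - j"] by simp
qed

text \<open>The stabilisation index drops out: beyond it neighbours agree, so the local formula
  gives \<open>0\<close> there as well.\<close>

lemma Comaj_exp_eq:
  assumes "\<sigma> \<in> RSinf R n"
  shows "Comaj_exp R n \<sigma> j = (if j = 0 then 0 else inv_comaj n (\<sigma> (j + 1)) (\<sigma> j))"
proof -
  define m where "m = mstab R n \<sigma>"
  have \<sigma>: "\<And>i. \<sigma> i permutes {1..n}" "\<sigma> 1 = id"
    using assms unfolding RSinf_def by auto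
  obtain M where "\<forall>i>M. \<sigma> i = tauR R n" using assms unfolding RSinf_def by blast
  then have "1 \<le> max 1 M \<and> (\<forall>i>max 1 M. \<sigma> i = tauR R n)" by simp
  then have m: "1 \<le> m \<and> (\<forall>i>m. \<sigma> i = tauR R n)"
    unfolding m_def mstab_def by (rule LeastI)
  have "Comaj_exp R n \<sigma> j = (if j \<in> {1..m} then comaj R n m (rev_tuple m \<sigma>) (m - j + 1) else 0)"
    unfolding Comaj_exp_def Let_def m_def[symmetric] rev_tuple_def[abs_def] ..
  moreover have "inv_comaj n (\<sigma> (j + 1)) (\<sigma> j) = 0" if "m < j"
    using inv_comaj_eq_0_iff[OF \<sigma>(1) \<sigma>(1), of "j + 1" j] m that by simp
  ultimately show ?thesis using comaj_rev_tuple[of \<sigma> n m R j] \<sigma> m by auto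
qed

text \<open>Exponents vanishing beyond \<open>k\<close> make neighbours beyond \<open>k\<close>
  equal, and the eventual value is \<open>tauR\<close>. Only the permutations of index
  \<open>2\<close> to \<open>k\<close> remain free, and they form the reversed tuple.\<close>

lemma bij_betw_num_inf_set:
  assumes k: "1 \<le> k" and e: "\<forall>i. i \<notin> {1..k} \<longrightarrow> e i = 0"
  shows "bij_betw (rev_tuple k) (num_inf_set n R e) (num_fin_set n R k (rev_mon k e))"
proof -
  let ?\<tau> = "tauR R n"
  have \<tau>: "?\<tau> permutes {1..n}" using sorts_tauR[of n R] unfolding sorts_def by blast
  define B where "B = {\<sigma>. (\<forall>i. \<sigma> i permutes {1..n}) \<and> \<sigma> 0 = id \<and> \<sigma> 1 = id \<and> (\<forall>i>k. \<sigma> i = ?\<tau>)}"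
  have BD: "\<sigma> i permutes {1..n}" "\<sigma> 0 = id" "\<sigma> 1 = id" "k < i \<Longrightarrow> \<sigma> i = ?\<tau>" if "\<sigma> \<in> B" for \<sigma> i
    using that unfolding B_def by auto
  have B: "B \<subseteq> RSinf R n" unfolding B_def RSinf_def by blast
  have bij: "bij_betw (rev_tuple k) B (perm_tuples n k)"
  proof (rule bij_betw_byWitness[where
        f' = "\<lambda>\<pi> i. if i \<le> 1 then id else if i \<le> k then \<pi> (k + 1 - i) else ?\<tau>"])
    show "\<forall>\<sigma>\<in>B. (\<lambda>i. if i \<le> 1 then id else if i \<le> k then rev_tuple k \<sigma> (k + 1 - i) else ?\<tau>) = \<sigma>"
    proof (rule ballI, rule ext)
      fix \<sigma> i assume "\<sigma> \<in> B"
      note \<sigma> = BD[OF this]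
      consider "i = 0" | "i = 1" | "1 < i" "i \<le> k" | "1 < i" "k < i" by linarith
      then show "(if i \<le> 1 then id else if i \<le> k then rev_tuple k \<sigma> (k + 1 - i) else ?\<tau>) = \<sigma> i"
        by cases (use \<sigma>(2-4) in \<open>auto simp: rev_tuple_def\<close>)
    qed
    show "\<forall>\<pi>\<in>perm_tuples n k.
        rev_tuple k (\<lambda>i. if i \<le> 1 then id else if i \<le> k then \<pi> (k + 1 - i) else ?\<tau>) = \<pi>"
    proof (rule ballI, rule ext)
      fix \<pi> i assume "\<pi> \<in> perm_tuples n k"
      then show "rev_tuple k (\<lambda>i. if i \<le> 1 then id else if i \<le> k then \<pi> (k + 1 - i) else ?\<tau>) i = \<pi> i"
        unfolding rev_tuple_def perm_tuples_def by auto
    qed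
    show "rev_tuple k ` B \<subseteq> perm_tuples n k"
      using BD(1) unfolding perm_tuples_def rev_tuple_def by auto
    show "(\<lambda>\<pi> i. if i \<le> 1 then id else if i \<le> k then \<pi> (k + 1 - i) else ?\<tau>) ` perm_tuples n k \<subseteq> B"
      using \<tau> k unfolding B_def perm_tuples_def by (auto simp: permutes_id)
  qed
  have iff: "(\<forall>i. rev_mon k e i = (if i \<in> {1..k} then comaj R n k (rev_tuple k \<sigma>) i else 0)) \<longleftrightarrow>
      Comaj_exp R n \<sigma> = e" (is "?l \<longleftrightarrow> ?r") if "\<sigma> \<in> B" for \<sigma>
  proof -
    note \<sigma> = BD[OF that]
    let ?c = "\<lambda>j. inv_comaj n (\<sigma> (j + 1)) (\<sigma> j)"
    have c: "comaj R n k (rev_tuple k \<sigma>) (k + 1 - j) = ?c j" if "j \<in> {1..k}" for j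
      using comaj_rev_tuple[of \<sigma> n k R j] \<sigma> that by (simp add: Suc_diff_le)
    have "?l \<longleftrightarrow> (\<forall>i\<in>{1..k}. rev_mon k e i = comaj R n k (rev_tuple k \<sigma>) i)"
      unfolding rev_mon_def by auto
    also have "\<dots> \<longleftrightarrow> (\<forall>j\<in>{1..k}. rev_mon k e (k + 1 - j) = comaj R n k (rev_tuple k \<sigma>) (k + 1 - j))"
      by (rule ball_rev[symmetric])
    also have "\<dots> \<longleftrightarrow> (\<forall>j\<in>{1..k}. e j = ?c j)"
    proof (rule ball_cong[OF refl])
      fix j assume j: "j \<in> {1..k}"
      then have "k + 1 - j \<in> {1..k}" "k + 1 - (k + 1 - j) = j" by auto
      then show "rev_mon k e (k + 1 - j) = comaj R n k (rev_tuple k \<sigma>) (k + 1 - j) \<longleftrightarrow> e j = ?c j"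
        unfolding c[OF j] rev_mon_def by simp
    qed
    also have "\<dots> \<longleftrightarrow> ?r"
    proof -
      have "Comaj_exp R n \<sigma> j = (if j \<in> {1..k} then ?c j else 0)" for j
        using inv_comaj_eq_0_iff[OF \<sigma>(1) \<sigma>(1), of "j + 1" j] \<sigma>(4)[of j] \<sigma>(4)[of "j + 1"]
        unfolding Comaj_exp_eq[OF subsetD[OF B \<open>\<sigma> \<in> B\<close>]] by auto
      then show ?thesis using e unfolding fun_eq_iff by auto
    qed
    finally show ?thesis .
  qed
  have eq: "num_inf_set n R e = {\<sigma>\<in>B. Comaj_exp R n \<sigma> = e}"
  proof (intro equalityI subsetI)
    fix \<sigma> assume "\<sigma> \<in> num_inf_set n R e"
    then have \<sigma>: "\<sigma> \<in> RSinf R n" "Comaj_exp R n \<sigma> = e" unfolding num_inf_set_def by auto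
    then have p: "\<sigma> i permutes {1..n}" for i unfolding RSinf_def by blast
    obtain M where M: "\<And>i. M < i \<Longrightarrow> \<sigma> i = ?\<tau>" using \<sigma> unfolding RSinf_def by blast
    have "\<sigma> i = ?\<tau>" if i: "k < i" for i
    proof -
      have step: "\<sigma> j = \<sigma> (j + 1)" if "k < j" for j
        using Comaj_exp_eq[OF \<sigma>(1), of j] \<sigma>(2) e that inv_comaj_eq_0_iff[OF p p] by auto
      \<comment> \<open>Equality of neighbours carries the value at \<open>i\<close> to an index
        past \<open>M\<close>, where it is \<open>tauR\<close>.\<close>
      have "\<sigma> (i + d) = \<sigma> i" for d
      proof (induction d)
        case (Suc d)
        then show ?case using step[of "i + d"] i by simp
      qed simp
      from this[of "Suc M"] M[of "i + Suc M"] show ?thesis by simp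
    qed
    then show "\<sigma> \<in> {\<sigma>\<in>B. Comaj_exp R n \<sigma> = e}"
      using \<sigma> p unfolding B_def RSinf_def by blast
  qed (use B in \<open>auto simp: num_inf_set_def\<close>)
  show ?thesis
    unfolding eq num_fin_set_def by (rule bij_betw_Collect[OF bij]) (rule iff)
qed

text \<open>Reversal permutes the splittings of a monomial and commutes with taking the
  complementary factor; all factors stay within the first \<open>k\<close> variables, where the
  series are compared.\<close>

lemma mps_mult_rev_mon:
  assumes e: "\<forall>i. i \<notin> {1..k} \<longrightarrow> e i = 0"
    and f: "\<And>d. \<forall>i. i \<notin> {1..k} \<longrightarrow> d i = 0 \<Longrightarrow> f d = f' (rev_mon k d)"
    and g: "\<And>d. \<forall>i. i \<notin> {1..k} \<longrightarrow> d i = 0 \<Longrightarrow> g d = g' (rev_mon k d)"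
  shows "mps_mult f g e = mps_mult f' g' (rev_mon k e)"
  unfolding mps_mult_def
proof (rule sum.reindex_bij_witness[where i = "rev_mon k" and j = "rev_mon k"])
  fix d assume "d \<in> {d. \<forall>i. d i \<le> e i}"
  then have le: "d i \<le> e i" for i by blast
  have d: "\<forall>i. i \<notin> {1..k} \<longrightarrow> d i = 0" using le e by (metis le_zero_eq)
  show "rev_mon k (rev_mon k d) = d" using d by (rule rev_mon_rev_mon)
  show "rev_mon k d \<in> {d. \<forall>i. d i \<le> rev_mon k e i}" using le by (simp add: rev_mon_def)
  have "rev_mon k (\<lambda>i. e i - d i) = (\<lambda>i. rev_mon k e i - rev_mon k d i)"
    by (auto simp: rev_mon_def)
  then show "f' (rev_mon k d) * g' (\<lambda>i. rev_mon k e i - rev_mon k d i) = f d * g (\<lambda>i. e i - d i)"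
    using f[of d] g[of "\<lambda>i. e i - d i"] d e by simp
next
  fix d assume "d \<in> {d. \<forall>i. d i \<le> rev_mon k e i}"
  then have le: "d i \<le> rev_mon k e i" for i by blast
  show "rev_mon k (rev_mon k d) = d"
    by (rule rev_mon_rev_mon) (metis le le_zero_eq rev_mon_outside)
  have "rev_mon k d i \<le> rev_mon k (rev_mon k e) i" for i using le by (simp add: rev_mon_def)
  then show "rev_mon k d \<in> {d. \<forall>i. d i \<le> e i}"
    unfolding rev_mon_rev_mon[OF e] by blast
qed

lemma qpoch_prod_rev_mon:
  assumes d: "\<forall>i. i \<notin> {1..k} \<longrightarrow> d i = 0"
  shows "qpoch_prod n {1..} d = qpoch_prod n {1..k} (rev_mon k d)"
proof -
  have "qpoch_prod n {1..} d = (\<Prod>i\<in>{1..k}. coeff (qpoch n) (d i))"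
    using d by (rule qpoch_prod_eq) auto
  also have "\<dots> = (\<Prod>i\<in>{1..k}. coeff (qpoch n) (d (k + 1 - i)))"
    by (rule prod.atLeastAtMost_rev)
  also have "\<dots> = (\<Prod>i\<in>{1..k}. coeff (qpoch n) (rev_mon k d i))"
    by (rule prod.cong) (auto simp: rev_mon_def)
  also have "\<dots> = qpoch_prod n {1..k} (rev_mon k d)"
    by (rule qpoch_prod_eq[symmetric]) (auto simp: rev_mon_outside)
  finally show ?thesis .
qed

lemma F_inf_mult_qpoch_prod:
  assumes R: "R \<subseteq> {1..<n}" and k: "1 \<le> k" and e: "\<forall>i. i \<notin> {1..k} \<longrightarrow> e i = 0"
  shows "mps_mult (F_inf n R) (qpoch_prod n {1..}) e = num_inf n R e"
proof -
  have "mps_mult (F_inf n R) (qpoch_prod n {1..}) e =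
      mps_mult (F_fin n R k) (qpoch_prod n {1..k}) (rev_mon k e)"
  proof (rule mps_mult_rev_mon[OF e])
    fix d :: mon assume d: "\<forall>i. i \<notin> {1..k} \<longrightarrow> d i = 0"
    show "F_inf n R d = F_fin n R k (rev_mon k d)"
      unfolding F_inf_def F_fin_def using bij_betw_same_card[OF bij_betw_F_inf_set[OF R d]] by simp
    show "qpoch_prod n {1..} d = qpoch_prod n {1..k} (rev_mon k d)"
      using d by (rule qpoch_prod_rev_mon)
  qed
  also have "\<dots> = num_fin n R k (rev_mon k e)"
    by (rule F_fin_mult_qpoch_prod[OF R k])
  also have "\<dots> = num_inf n R e"
    unfolding num_fin_def num_inf_def using bij_betw_same_card[OF bij_betw_num_inf_set[OF k e]] by simp
  finally show ?thesis .
qed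

lemma finite_and_F_inf_mult_qpoch_prod:
  assumes R: "R \<subseteq> {1..<n}" and e: "finsupp_mon e"
  shows "finite (F_inf_set n R e) \<and> finite (num_inf_set n R e) \<and>
    mps_mult (F_inf n R) (qpoch_prod n {1..}) e = num_inf n R e"
proof (cases "e 0 = 0")
  case True
  \<comment> \<open>Inserting \<open>0\<close> keeps \<open>Max\<close> defined for the constant
    monomial, and \<open>Suc\<close> ensures \<open>1 \<le> k\<close>.\<close>
  define k where "k = Suc (Max (insert 0 {i. e i \<noteq> 0}))"
  have k: "1 \<le> k" unfolding k_def by simp
  have e': "\<forall>i. i \<notin> {1..k} \<longrightarrow> e i = 0"
  proof (intro allI impI, rule ccontr)
    fix i assume "i \<notin> {1..k}" "e i \<noteq> 0"
    then have "i \<le> Max (insert 0 {i. e i \<noteq> 0})"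
      using e unfolding finsupp_mon_def by (intro Max_ge) auto
    then show False using \<open>i \<notin> {1..k}\<close> \<open>e i \<noteq> 0\<close> True unfolding k_def by (cases "i = 0") auto
  qed
  have "finite (F_inf_set n R e)"
    using bij_betw_finite[OF bij_betw_F_inf_set[OF R e']] finite_F_fin_set[OF R k] by simp
  moreover have "finite (num_inf_set n R e)"
    using bij_betw_finite[OF bij_betw_num_inf_set[OF k e']] finite_num_fin_set by simp
  ultimately show ?thesis using F_inf_mult_qpoch_prod[OF R k e'] by simp
next
  case False
  \<comment> \<open>Index \<open>0\<close> stands for no variable: sequences in
    \<open>F_inf_set\<close> vanish there, and so does \<open>Comaj_exp\<close>, hence both sides
    are \<open>0\<close>.\<close>
  have F: "F_inf_set n R d = {}" if "d 0 \<noteq> 0" for d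
    using that unfolding F_inf_set_def by fastforce
  have N: "num_inf_set n R e = {}"
    using False Comaj_exp_eq[of _ R n 0] unfolding num_inf_set_def by auto
  have "mps_mult (F_inf n R) (qpoch_prod n {1..}) e = 0"
  proof (rule mps_mult_eq_0[where V = "{1..}" and i = 0 and e = e])
    show "F_inf n R d = 0" if "\<exists>i. i \<notin> {1..} \<and> d i \<noteq> 0" for d
      using that F[of d] unfolding F_inf_def by (auto simp: not_less_eq_eq)
  qed (use False in \<open>auto simp: qpoch_prod_def\<close>)
  then show ?thesis using F[of e] N False by (simp add: num_inf_def)
qed

theorem theorem8:
  fixes n :: nat and R :: "nat set"
  assumes "n \<ge> 1" and "R \<subseteq> {1..<n}"
  shows "(\<forall>k\<ge>1. \<forall>e. finsupp_mon e \<longrightarrow>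
            finite (F_fin_set n R k e) \<and> finite (num_fin_set n R k e) \<and>
            mps_mult (F_fin n R k) (qpoch_prod n {1..k}) e = num_fin n R k e)
       \<and> (\<forall>e. finsupp_mon e \<longrightarrow>
            finite (F_inf_set n R e) \<and> finite (num_inf_set n R e) \<and>
            mps_mult (F_inf n R) (qpoch_prod n {1..}) e = num_inf n R e)"
  using finite_F_fin_set[OF assms(2)] finite_num_fin_set F_fin_mult_qpoch_prod[OF assms(2)]
    finite_and_F_inf_mult_qpoch_prod[OF assms(2)]
  by blast

end
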